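(* Let $D\in\mathrm{Mat}_{d\times d}(\mathcal{L})$ be a non-zero matrix ($d\ge1$), and let $\lambda_d\in\mathcal{L}[t]$ be its last invariant factor. For $n\ge1$ let $s_n$ be the least non-negative integer such that all entries of $D,D^2,\dots,D^n$ have valuation $\ge -s_n$. The following are equivalent: (1) there is $n\ge1$ such that $\sigma^{s_n}D^n\in\mathrm{Mat}_{d\times d}(\mathcal{O})$ has rank $d$ modulo $\sigma^{s_n}$; (2) there is $n\ge1$ such that the block column matrix with blocks $\sigma^{s_n}D,\sigma^{s_n}D^2,\dots,\sigma^{s_n}D^n$ (stacked vertically, in $\mathrm{Mat}_{nd\times d}(\mathcal{O})$) has rank $d$ modulo $\sigma^{s_n}$; (2') there is $n\ge1$ such that the block row matrix $(\sigma^{s_n}D,\sigma^{s_n}D^2,\dots,\sigma^{s_n}D^n)\in\mathrm{Mat}_{d\times nd}(\mathcal{O})$ has rank $d$ modulo $\sigma^{s_n}$; (3) all slopes of the Newton polygon of $\lambda_d$ are positive.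
   Context: $(\mathcal{L},v)$ is a complete discretely valued skew field: a division ring with a map $v:\mathcal{L}\to\mathbb{Z}\cup\{\infty\}$ with $v(x)=\infty\iff x=0$, $v(x+y)\ge\min\{v(x),v(y)\}$, $v(xy)=v(x)+v(y)$, such that every series $\sum x_i$ with $v(x_i)\to\infty$ converges. $\mathcal{O}=\{x:v(x)\ge0\}$ is its valuation ring and $\sigma\in\mathcal{O}$ a fixed uniformizer ($v(\sigma)=1$). $\mathcal{L}[t]$ is the polynomial ring in a central indeterminate $t$. Rank modulo $\sigma^s$: any rectangular matrix $B$ over $\mathcal{O}$ can be brought by elementary row and column operations over $\mathcal{O}$ to a diagonal form whose non-zero diagonal entries are $\sigma^{\nu_1},\dots,\sigma^{\nu_n}$ with $0\le\nu_1\le\dots\le\nu_n$; $B$ has rank $r$ modulo $\sigma^s$ if $\#\{i:\nu_i<s\}=r$. Invariant factors of $D$: monic $\lambda_1,\dots,\lambda_d\in\mathcal{L}[t]$ obtained by bringing $t\mathbf{1}_d-D$ to diagonal form $\mathrm{diag}(\lambda_1,\dots,\lambda_d)$ by elementary row and column operations over $\mathcal{L}[t]$, with each $\lambda_i$ a left and right divisor of $\lambda_{i+1}$ (Newton polygons are independent of choices). Newton polygon of $f=\sum a_it^i\in\mathcal{L}[t]$: lower convex hull of the points $(i,v(a_i))$, $a_i\ne0$; slope of an edge from $(i,w_i)$ to $(j,w_j)$ is $(w_j-w_i)/(j-i)$. "All slopes positive" is understood to include that the constant coefficient is non-zero. *)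

theory Defs
  imports "HOL-Computational_Algebra.Polynomial" "Jordan_Normal_Form.Matrix"
begin

text \<open>The valuation is a map v :: 'a => int; the value v(0) = infinity is encoded by
  treating 0 separately: val_ge v x k means v(x) >= k (always true for x = 0).\<close>

definition val_ge :: "('a::division_ring \<Rightarrow> int) \<Rightarrow> 'a \<Rightarrow> int \<Rightarrow> bool" where
  "val_ge v x k \<longleftrightarrow> x = 0 \<or> k \<le> v x"

definition complete_dvf :: "('a::division_ring \<Rightarrow> int) \<Rightarrow> 'a \<Rightarrow> bool" where
  "complete_dvf v \<sigma> \<longleftrightarrow>
     (\<forall>x y. x \<noteq> 0 \<longrightarrow> y \<noteq> 0 \<longrightarrow> v (x * y) = v x + v y)
   \<and> (\<forall>x y. x \<noteq> 0 \<longrightarrow> y \<noteq> 0 \<longrightarrow> x + y \<noteq> 0 \<longrightarrow> min (v x) (v y) \<le> v (x + y))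
   \<and> \<sigma> \<noteq> 0 \<and> v \<sigma> = 1
   \<and> (\<forall>x :: nat \<Rightarrow> 'a. (\<forall>k. \<forall>\<^sub>F i in sequentially. val_ge v (x i) k) \<longrightarrow>
        (\<exists>s. \<forall>k. \<forall>\<^sub>F n in sequentially. val_ge v ((\<Sum>i<n. x i) - s) k))"

definition val_ring :: "('a::division_ring \<Rightarrow> int) \<Rightarrow> 'a set" where
  "val_ring v = {x. val_ge v x 0}"

definition is_unit_in :: "('b \<Rightarrow> 'b \<Rightarrow> 'b) \<Rightarrow> 'b \<Rightarrow> 'b set \<Rightarrow> 'b \<Rightarrow> bool" where
  "is_unit_in mul e R u \<longleftrightarrow> u \<in> R \<and> (\<exists>w\<in>R. mul u w = e \<and> mul w u = e)"

definition elem_step :: "('b::ab_group_add \<Rightarrow> 'b \<Rightarrow> 'b) \<Rightarrow> 'b \<Rightarrow> 'b set \<Rightarrow> 'b mat \<Rightarrow> 'b mat \<Rightarrow> bool" where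
  "elem_step mul e R A B \<longleftrightarrow>
    (let nr = dim_row A; nc = dim_col A in
     (\<exists>i<nr. \<exists>j<nr. B = mat nr nc (\<lambda>(k,l). A $$ (if k = i then j else if k = j then i else k, l)))
   \<or> (\<exists>i<nr. \<exists>u. is_unit_in mul e R u \<and>
        B = mat nr nc (\<lambda>(k,l). if k = i then mul u (A $$ (k,l)) else A $$ (k,l)))
   \<or> (\<exists>i<nr. \<exists>j<nr. \<exists>c\<in>R. i \<noteq> j \<and>
        B = mat nr nc (\<lambda>(k,l). if k = i then A $$ (i,l) + mul c (A $$ (j,l)) else A $$ (k,l)))
   \<or> (\<exists>i<nc. \<exists>j<nc. B = mat nr nc (\<lambda>(k,l). A $$ (k, if l = i then j else if l = j then i else l)))
   \<or> (\<exists>i<nc. \<exists>u. is_unit_in mul e R u \<and>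
        B = mat nr nc (\<lambda>(k,l). if l = i then mul (A $$ (k,l)) u else A $$ (k,l)))
   \<or> (\<exists>i<nc. \<exists>j<nc. \<exists>c\<in>R. i \<noteq> j \<and>
        B = mat nr nc (\<lambda>(k,l). if l = i then A $$ (k,i) + mul (A $$ (k,j)) c else A $$ (k,l))))"

definition elem_reduces :: "('b::ab_group_add \<Rightarrow> 'b \<Rightarrow> 'b) \<Rightarrow> 'b \<Rightarrow> 'b set \<Rightarrow> 'b mat \<Rightarrow> 'b mat \<Rightarrow> bool" where
  "elem_reduces mul e R = (elem_step mul e R)\<^sup>*\<^sup>*"

definition sigma_diag_form :: "'a::division_ring \<Rightarrow> 'a mat \<Rightarrow> nat \<Rightarrow> (nat \<Rightarrow> nat) \<Rightarrow> bool" where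
  "sigma_diag_form \<sigma> B k \<nu> \<longleftrightarrow>
     k \<le> min (dim_row B) (dim_col B)
   \<and> (\<forall>i<dim_row B. \<forall>j<dim_col B. i \<noteq> j \<longrightarrow> B $$ (i,j) = 0)
   \<and> (\<forall>i<k. B $$ (i,i) = \<sigma> ^ \<nu> i)
   \<and> (\<forall>i. k \<le> i \<longrightarrow> i < min (dim_row B) (dim_col B) \<longrightarrow> B $$ (i,i) = 0)
   \<and> (\<forall>i j. i \<le> j \<longrightarrow> j < k \<longrightarrow> \<nu> i \<le> \<nu> j)"

definition rank_mod :: "('a::division_ring \<Rightarrow> int) \<Rightarrow> 'a \<Rightarrow> nat \<Rightarrow> 'a mat \<Rightarrow> nat \<Rightarrow> bool" where
  "rank_mod v \<sigma> s B r \<longleftrightarrow>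
     (\<exists>B' k \<nu>. elem_reduces (*) 1 (val_ring v) B B' \<and> sigma_diag_form \<sigma> B' k \<nu>
        \<and> card {i. i < k \<and> \<nu> i < s} = r)"

definition pmult :: "'a::ring poly \<Rightarrow> 'a poly \<Rightarrow> 'a poly" where
  "pmult p q = (\<Sum>i\<le>degree p. \<Sum>j\<le>degree q. monom (coeff p i * coeff q j) (i + j))"

definition pone :: "'a::ring_1 poly" where
  "pone = [:1:]"

definition monic_poly :: "'a::ring_1 poly \<Rightarrow> bool" where
  "monic_poly p \<longleftrightarrow> p \<noteq> 0 \<and> lead_coeff p = 1"

definition left_divides :: "'a::ring poly \<Rightarrow> 'a poly \<Rightarrow> bool" where
  "left_divides a b \<longleftrightarrow> (\<exists>c. b = pmult a c)"

definition right_divides :: "'a::ring poly \<Rightarrow> 'a poly \<Rightarrow> bool" where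
  "right_divides a b \<longleftrightarrow> (\<exists>c. b = pmult c a)"

definition char_mat :: "'a::division_ring mat \<Rightarrow> 'a poly mat" where
  "char_mat D = mat (dim_row D) (dim_col D)
     (\<lambda>(i,j). if i = j then [:- D $$ (i,j), 1:] else [:- D $$ (i,j):])"

definition invariant_factors :: "'a::division_ring mat \<Rightarrow> (nat \<Rightarrow> 'a poly) \<Rightarrow> bool" where
  "invariant_factors D lam \<longleftrightarrow>
     (let d = dim_row D in
       elem_reduces pmult pone UNIV (char_mat D) (mat d d (\<lambda>(i,j). if i = j then lam i else 0))
     \<and> (\<forall>i<d. monic_poly (lam i))
     \<and> (\<forall>i. i + 1 < d \<longrightarrow> left_divides (lam i) (lam (i+1)) \<and> right_divides (lam i) (lam (i+1))))"

text \<open>The lower convex hull of the points (i, v(a_i)), a_i \<noteq> 0, as a function of the abscissa.\<close>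
definition newton_fun :: "('a::division_ring \<Rightarrow> int) \<Rightarrow> 'a poly \<Rightarrow> real \<Rightarrow> real" where
  "newton_fun v f x = Inf {(\<Sum>i\<in>S. c i * real_of_int (v (coeff f i))) | S c.
       finite S \<and> S \<subseteq> {i. coeff f i \<noteq> 0} \<and> (\<forall>i\<in>S. 0 \<le> c i) \<and> (\<Sum>i\<in>S. c i) = 1
       \<and> (\<Sum>i\<in>S. c i * real i) = x}"

text \<open>All slopes of the Newton polygon are positive (including: constant coefficient non-zero),
  i.e. the polygon, defined on [0, deg f], is strictly increasing.\<close>
definition np_slopes_positive :: "('a::division_ring \<Rightarrow> int) \<Rightarrow> 'a poly \<Rightarrow> bool" where
  "np_slopes_positive v f \<longleftrightarrow> coeff f 0 \<noteq> 0 \<and>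
     strict_mono_on {0..real (degree f)} (newton_fun v f)"

definition s_seq :: "('a::division_ring \<Rightarrow> int) \<Rightarrow> 'a mat \<Rightarrow> nat \<Rightarrow> nat" where
  "s_seq v D n = (LEAST s::nat. \<forall>k\<in>{1..n}. \<forall>i<dim_row D. \<forall>j<dim_col D.
       val_ge v ((D ^\<^sub>m k) $$ (i,j)) (- int s))"

definition block_col :: "'a::division_ring \<Rightarrow> nat \<Rightarrow> 'a mat \<Rightarrow> nat \<Rightarrow> 'a mat" where
  "block_col \<sigma> s D n = (let d = dim_row D in
     mat (n * d) d (\<lambda>(i,j). \<sigma> ^ s * (D ^\<^sub>m (i div d + 1)) $$ (i mod d, j)))"

definition block_row :: "'a::division_ring \<Rightarrow> nat \<Rightarrow> 'a mat \<Rightarrow> nat \<Rightarrow> 'a mat" where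
  "block_row \<sigma> s D n = (let d = dim_row D in
     mat d (n * d) (\<lambda>(i,j). \<sigma> ^ s * (D ^\<^sub>m (j div d + 1)) $$ (i, j mod d)))"

end

theory Submission
  imports Defs "HOL-Computational_Algebra.Formal_Power_Series"
    "Jordan_Normal_Form.Gauss_Jordan_Elimination"
begin

text \<open>Each rank condition says that a matrix has a one-sided inverse whose entries have valuation
  \<open>\<ge> 1 - s\<close>. For (1), (2) and (2') this amounts to a relation \<open>X D\<^sup>n = 1\<close>, \<open>\<Sum> C\<^sub>k D\<^sup>k = 1\<close> or
  \<open>\<Sum> D\<^sup>k C\<^sub>k = 1\<close> with coefficients of positive valuation. Multiplied by powers of \<open>E = D\<^sup>-\<^sup>1\<close>,
  such a relation becomes a contracting linear recursion for \<open>E\<^sup>m\<close>; so all three are equivalent to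
  \<open>D\<close> being invertible with \<open>E\<^sup>m \<longrightarrow> 0\<close>.

  Since \<open>(t - D)\<^sup>-\<^sup>1 = - \<Sum> E\<^sup>m\<^sup>+\<^sup>1 t\<^sup>m\<close>, this holds iff \<open>t - D\<close> is left invertible over the ring of
  power series whose coefficients tend to zero. Elementary operations over the polynomial ring
  preserve this property, so it holds iff all invariant factors are left invertible there, equivalently
  the last one, as it is a multiple of the others. By a Gauss lemma, a polynomial is left
  invertible there iff its constant coefficient has strictly smaller valuation than all others, that is, iff
  its Newton polygon has positive slopes.\<close>

section \<open>Elementary operations and one-sided inverses\<close>

text \<open>Since the entries need not commute, no determinant is used: everything is phrased
  through the existence of one-sided inverses, which survives multiplication by invertible matrices
  on either side. The threshold \<open>1 - s\<close> comes from the diagonal form: inverting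
  \<open>\<sigma> ^ \<nu> i\<close> produces valuation \<open>- \<nu> i\<close>, and for integers
  \<open>\<nu> i < s\<close> is the same as \<open>- \<nu> i \<ge> 1 - s\<close>. The factor
  \<open>\<sigma> ^ s\<close> in front of the powers of \<open>D\<close> then turns
  \<open>1 - s\<close> into \<open>1\<close>, and this strict gain is what makes the recursion
  contract. As \<open>\<sigma>\<close> need not commute with the entries of \<open>D\<close>, powers
  of \<open>\<sigma>\<close> must stay on the side where they arise; they are either absorbed by the
  neighbouring factor or removed by conjugation. The Gauss lemma survives noncommutativity because
  \<open>v\<close> is multiplicative: the product of the two last minimal coefficients cannot be
  cancelled by terms of larger valuation.\<close>

definition subring1 :: "'a::ring_1 set \<Rightarrow> bool" where
  "subring1 R \<longleftrightarrow> 0 \<in> R \<and> 1 \<in> R \<and> (\<forall>x\<in>R. - x \<in> R) \<and> (\<forall>x\<in>R. \<forall>y\<in>R. x + y \<in> R \<and> x * y \<in> R)"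

text \<open>Inverses may have entries outside the ring used for the operations. The set
  \<open>{x. val_ge v x (1 - int s)}\<close> is stable under integral factors on both sides, but for
  \<open>s > 1\<close> not under its own multiplication, so a bimodule is the fitting
  structure.\<close>

definition bimodule_over :: "'a::ring_1 set \<Rightarrow> 'a set \<Rightarrow> bool" where
  "bimodule_over R I \<longleftrightarrow> 0 \<in> I \<and> (\<forall>x\<in>I. \<forall>y\<in>I. x + y \<in> I) \<and>
     (\<forall>r\<in>R. \<forall>x\<in>I. r * x \<in> I \<and> x * r \<in> I)"

definition mat_over :: "'a set \<Rightarrow> 'a mat \<Rightarrow> bool" where
  "mat_over I A \<longleftrightarrow> (\<forall>i<dim_row A. \<forall>j<dim_col A. A $$ (i,j) \<in> I)"

definition left_inv_over :: "'a::semiring_1 set \<Rightarrow> 'a mat \<Rightarrow> bool" where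
  "left_inv_over I A \<longleftrightarrow> (\<exists>C\<in>carrier_mat (dim_col A) (dim_row A).
     mat_over I C \<and> C * A = 1\<^sub>m (dim_col A))"

definition right_inv_over :: "'a::semiring_1 set \<Rightarrow> 'a mat \<Rightarrow> bool" where
  "right_inv_over I A \<longleftrightarrow> (\<exists>C\<in>carrier_mat (dim_col A) (dim_row A).
     mat_over I C \<and> A * C = 1\<^sub>m (dim_row A))"

definition unit_over :: "'a::semiring_1 set \<Rightarrow> nat \<Rightarrow> 'a mat \<Rightarrow> bool" where
  "unit_over R n P \<longleftrightarrow> P \<in> carrier_mat n n \<and> mat_over R P \<and>
     (\<exists>P'\<in>carrier_mat n n. mat_over R P' \<and> P * P' = 1\<^sub>m n \<and> P' * P = 1\<^sub>m n)"

lemma bimodule_over_UNIV: "bimodule_over R (UNIV :: 'a::ring_1 set)"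
  by (auto simp: bimodule_over_def)

lemma mat_index_mult_sum:
  "A \<in> carrier_mat n m \<Longrightarrow> B \<in> carrier_mat m k \<Longrightarrow> i < n \<Longrightarrow> j < k \<Longrightarrow>
    (A * B) $$ (i,j) = (\<Sum>l<m. A $$ (i,l) * B $$ (l,j))"
  by (auto simp: scalar_prod_def atLeast0LessThan)

lemma bimodule_over_sum:
  assumes "bimodule_over R I" "\<And>i. i \<in> S \<Longrightarrow> f i \<in> I"
  shows "sum f S \<in> I"
  using assms(2)
  by (induction S rule: infinite_finite_induct) (use assms(1) in \<open>auto simp: bimodule_over_def\<close>)

lemma mat_over_mult_left:
  assumes "bimodule_over R I" "P \<in> carrier_mat n m" "mat_over R P" "C \<in> carrier_mat m k" "mat_over I C"
  shows "mat_over I (P * C)"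
  unfolding mat_over_def
proof (intro allI impI)
  fix i j assume "i < dim_row (P * C)" "j < dim_col (P * C)"
  with assms show "(P * C) $$ (i,j) \<in> I"
    by (subst mat_index_mult_sum[OF assms(2,4)])
      (auto intro!: bimodule_over_sum[OF assms(1)] simp: mat_over_def bimodule_over_def)
qed

lemma mat_over_mult_right:
  assumes "bimodule_over R I" "P \<in> carrier_mat m k" "mat_over R P" "C \<in> carrier_mat n m" "mat_over I C"
  shows "mat_over I (C * P)"
  unfolding mat_over_def
proof (intro allI impI)
  fix i j assume "i < dim_row (C * P)" "j < dim_col (C * P)"
  with assms show "(C * P) $$ (i,j) \<in> I"
    by (subst mat_index_mult_sum[OF assms(4,2)])
      (auto intro!: bimodule_over_sum[OF assms(1)] simp: mat_over_def bimodule_over_def)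
qed

text \<open>The new inverse is \<open>C * P'\<close> in both cases, and it stays over
  \<open>I\<close> because \<open>P'\<close> is over \<open>R\<close>. For a left inverse
  \<open>P' * P\<close> cancels in the middle; for a right inverse \<open>A * C = 1\<close>
  collapses between \<open>P\<close> and \<open>P'\<close>, so \<open>P\<close> has to be inverted
  on both sides.\<close>

lemma unit_over_left_imp:
  assumes I: "bimodule_over R I" and P: "unit_over R n P" and A: "A \<in> carrier_mat n m"
  shows "left_inv_over I A \<Longrightarrow> left_inv_over I (P * A)"
    and "right_inv_over I A \<Longrightarrow> right_inv_over I (P * A)"
proof -
  from P obtain P' where Pc: "P \<in> carrier_mat n n" "mat_over R P" and P': "P' \<in> carrier_mat n n"
    "mat_over R P'" and inv: "P * P' = 1\<^sub>m n" "P' * P = 1\<^sub>m n"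
    by (auto simp: unit_over_def)
  have dims: "dim_row (P * A) = n" "dim_col (P * A) = m" "dim_row A = n" "dim_col A = m"
    using A Pc by auto
  {
    assume "left_inv_over I A"
    then obtain C where C: "C \<in> carrier_mat m n" "mat_over I C" "C * A = 1\<^sub>m m"
      unfolding left_inv_over_def dims by auto
    have "(C * P') * (P * A) = C * ((P' * P) * A)"
      using C P' Pc A by (simp add: assoc_mult_mat[of _ _ n _ n _ m] assoc_mult_mat[of _ _ n _ n])
    also have "\<dots> = 1\<^sub>m m" using A C inv by simp
    finally have "(C * P') * (P * A) = 1\<^sub>m m" .
    then show "left_inv_over I (P * A)" unfolding left_inv_over_def dims
      using mat_over_mult_right[OF I P' C(1,2)] C(1) P'(1) by auto
  }
  {
    assume "right_inv_over I A"
    then obtain C where C: "C \<in> carrier_mat m n" "mat_over I C" "A * C = 1\<^sub>m n"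
      unfolding right_inv_over_def dims by auto
    have "A * (C * P') = P'"
      using assoc_mult_mat[OF A C(1) P'(1)] C(3) P' by simp
    then have "(P * A) * (C * P') = 1\<^sub>m n"
      using C P' Pc A inv by (simp add: assoc_mult_mat[of _ n n _ m _ n])
    then show "right_inv_over I (P * A)" unfolding right_inv_over_def dims
      using mat_over_mult_right[OF I P' C(1,2)] C(1) P'(1) by auto
  }
qed

lemma unit_over_right_imp:
  assumes I: "bimodule_over R I" and Q: "unit_over R m Q" and A: "A \<in> carrier_mat n m"
  shows "left_inv_over I A \<Longrightarrow> left_inv_over I (A * Q)"
    and "right_inv_over I A \<Longrightarrow> right_inv_over I (A * Q)"
proof -
  from Q obtain Q' where Qc: "Q \<in> carrier_mat m m" "mat_over R Q" and Q': "Q' \<in> carrier_mat m m"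
    "mat_over R Q'" and inv: "Q * Q' = 1\<^sub>m m" "Q' * Q = 1\<^sub>m m"
    by (auto simp: unit_over_def)
  have dims: "dim_row (A * Q) = n" "dim_col (A * Q) = m" "dim_row A = n" "dim_col A = m"
    using A Qc by auto
  {
    assume "left_inv_over I A"
    then obtain C where C: "C \<in> carrier_mat m n" "mat_over I C" "C * A = 1\<^sub>m m"
      unfolding left_inv_over_def dims by auto
    have "C * (A * Q) = Q"
      using assoc_mult_mat[OF C(1) A Qc(1)] C(3) Qc by simp
    then have "(Q' * C) * (A * Q) = 1\<^sub>m m"
      using C Q' Qc A inv by (simp add: assoc_mult_mat[of _ m m _ n _ m])
    then show "left_inv_over I (A * Q)" unfolding left_inv_over_def dims
      using mat_over_mult_left[OF I Q' C(1,2)] C(1) Q'(1) by auto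
  }
  {
    assume "right_inv_over I A"
    then obtain C where C: "C \<in> carrier_mat m n" "mat_over I C" "A * C = 1\<^sub>m n"
      unfolding right_inv_over_def dims by auto
    have "(A * Q) * (Q' * C) = A * ((Q * Q') * C)"
      using C Q' Qc A by (simp add: assoc_mult_mat[of _ n m _ m _ n] assoc_mult_mat[of _ m m _ m _ n])
    also have "\<dots> = 1\<^sub>m n" using C inv by simp
    finally have "(A * Q) * (Q' * C) = 1\<^sub>m n" .
    then show "right_inv_over I (A * Q)" unfolding right_inv_over_def dims
      using mat_over_mult_left[OF I Q' C(1,2)] C(1) Q'(1) by auto
  }
qed

lemma unit_over_left_iff:
  assumes I: "bimodule_over R I" and P: "unit_over R n P" and A: "A \<in> carrier_mat n m"
  shows "left_inv_over I (P * A) \<longleftrightarrow> left_inv_over I A"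
    and "right_inv_over I (P * A) \<longleftrightarrow> right_inv_over I A"
proof -
  from P obtain P' where Pc: "P \<in> carrier_mat n n" and P': "P' \<in> carrier_mat n n"
    and u: "unit_over R n P'" and inv: "P' * P = 1\<^sub>m n"
    by (auto simp: unit_over_def)
  have "P' * (P * A) = (P' * P) * A" using A P' Pc by (simp add: assoc_mult_mat[of _ n n _ n _ m])
  also have "\<dots> = A" using A inv by simp
  finally have eq: "P' * (P * A) = A" .
  show "left_inv_over I (P * A) \<longleftrightarrow> left_inv_over I A"
    "right_inv_over I (P * A) \<longleftrightarrow> right_inv_over I A"
    using unit_over_left_imp[OF I P A] unit_over_left_imp[OF I u, of "P * A" m] A Pc
    unfolding eq by auto
qed

lemma unit_over_right_iff:
  assumes I: "bimodule_over R I" and Q: "unit_over R m Q" and A: "A \<in> carrier_mat n m"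
  shows "left_inv_over I (A * Q) \<longleftrightarrow> left_inv_over I A"
    and "right_inv_over I (A * Q) \<longleftrightarrow> right_inv_over I A"
proof -
  from Q obtain Q' where Qc: "Q \<in> carrier_mat m m" and Q': "Q' \<in> carrier_mat m m"
    and u: "unit_over R m Q'" and inv: "Q * Q' = 1\<^sub>m m"
    by (auto simp: unit_over_def)
  have "(A * Q) * Q' = A * (Q * Q')" using A Q' Qc by (simp add: assoc_mult_mat[of _ n m _ m _ m])
  also have "\<dots> = A" using A inv by simp
  finally have eq: "(A * Q) * Q' = A" .
  show "left_inv_over I (A * Q) \<longleftrightarrow> left_inv_over I A"
    "right_inv_over I (A * Q) \<longleftrightarrow> right_inv_over I A"
    using unit_over_right_imp[OF I Q A] unit_over_right_imp[OF I u, of "A * Q" n] A Qc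
    unfolding eq by auto
qed

section \<open>Elementary matrices and the operations they induce\<close>

lemma unit_over_swaprows_mat:
  assumes "subring1 R" "k < n" "l < n"
  shows "unit_over R n (swaprows_mat n k l)"
proof -
  have "mat_over R (swaprows_mat n k l)"
    using assms by (auto simp: mat_over_def subring1_def)
  moreover have "swaprows_mat n k l * swaprows_mat n k l = (1\<^sub>m n :: 'a mat)"
    using assms by (intro swaprows_mat_inv)
  ultimately show ?thesis
    unfolding unit_over_def by (auto intro!: bexI[of _ "swaprows_mat n k l"])
qed

lemma unit_over_multrow_mat:
  assumes "subring1 R" "is_unit_in (*) 1 R u" "k < n"
  shows "unit_over R n (multrow_mat n k u)"
proof -
  from assms obtain w where w: "u \<in> R" "w \<in> R" "u * w = 1" "w * u = 1"
    by (auto simp: is_unit_in_def)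
  have "mat_over R (multrow_mat n k x)" if "x \<in> R" for x
    using assms(1) that by (auto simp: mat_over_def subring1_def)
  moreover have "multrow_mat n k x * multrow_mat n k y = 1\<^sub>m n" if "x * y = 1" for x y :: 'a
    using that by (subst multrow_mat[symmetric, of _ n n]) (auto intro!: eq_matI)
  ultimately show ?thesis
    unfolding unit_over_def using w by (auto intro!: bexI[of _ "multrow_mat n k w"])
qed

lemma unit_over_addrow_mat:
  assumes "subring1 R" "c \<in> R" "k < n" "l < n" "k \<noteq> l"
  shows "unit_over R n (addrow_mat n c k l)"
proof -
  have "mat_over R (addrow_mat n x k l)" if "x \<in> R" for x
    using assms(1) that by (auto simp: mat_over_def subring1_def)
  moreover have "addrow_mat n x k l * addrow_mat n y k l = 1\<^sub>m n" if "x + y = 0" for x y :: 'a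
    using that assms by (subst addrow_mat[symmetric, of _ n n]) (auto intro!: eq_matI)
  moreover have "- c \<in> R" using assms by (auto simp: subring1_def)
  ultimately show ?thesis
    unfolding unit_over_def using assms by (auto intro!: bexI[of _ "addrow_mat n (- c) k l"])
qed

lemma swapcols_eq_mult:
  assumes "A \<in> carrier_mat nr n" "k < n" "l < n"
  shows "mat nr n (\<lambda>(i,j). A $$ (i, if j = k then l else if j = l then k else j))
    = A * swaprows_mat n k l"
proof (rule eq_matI, goal_cases)
  case (1 i j)
  then have ij: "i < nr" "j < n" using assms(1) by auto
  have "(A * swaprows_mat n k l) $$ (i,j) = (\<Sum>m<n. A $$ (i,m) * swaprows_mat n k l $$ (m,j))"
    using assms ij by (intro mat_index_mult_sum) auto
  also have "\<dots> = (\<Sum>m<n. if m = (if j = k then l else if j = l then k else j) then A $$ (i,m) else 0)"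
    using ij assms by (intro sum.cong) auto
  finally show ?case using ij assms by (auto simp: sum.delta simp del: index_mult_mat)
qed (use assms in auto)

lemma multcol_eq_mult:
  assumes "A \<in> carrier_mat nr n" "k < n"
  shows "mat nr n (\<lambda>(i,j). if j = k then A $$ (i,j) * u else A $$ (i,j))
    = A * multrow_mat n k u"
proof (rule eq_matI, goal_cases)
  case (1 i j)
  then have ij: "i < nr" "j < n" using assms(1) by auto
  have "(A * multrow_mat n k u) $$ (i,j) = (\<Sum>l<n. A $$ (i,l) * multrow_mat n k u $$ (l,j))"
    using assms ij by (intro mat_index_mult_sum) auto
  also have "\<dots> = (\<Sum>l<n. if l = j then A $$ (i,l) * (if j = k then u else 1) else 0)"
    using ij by (intro sum.cong) auto
  finally show ?case using ij assms by (auto simp: sum.delta simp del: index_mult_mat)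
qed (use assms in auto)

text \<open>Acting from the right, the off-diagonal entry \<open>c\<close> must stand in row
  \<open>l\<close> and column \<open>k\<close>, hence the swapped indices of
  \<open>addrow_mat\<close>.\<close>

lemma addcol_eq_mult:
  assumes "A \<in> carrier_mat nr n" "k < n" "l < n" "k \<noteq> l"
  shows "mat nr n (\<lambda>(i,j). if j = k then A $$ (i,k) + A $$ (i,l) * c else A $$ (i,j))
    = A * addrow_mat n c l k"
proof (rule eq_matI, goal_cases)
  case (1 i j)
  then have ij: "i < nr" "j < n" using assms(1) by auto
  have "(A * addrow_mat n c l k) $$ (i,j) = (\<Sum>m<n. A $$ (i,m) * addrow_mat n c l k $$ (m,j))"
    using assms ij by (intro mat_index_mult_sum) auto
  also have "\<dots> = (\<Sum>m<n. (if m = j then A $$ (i,m) else 0)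
      + (if m = l then if j = k then A $$ (i,m) * c else 0 else 0))"
    using ij assms by (intro sum.cong) auto
  finally show ?case using ij assms by (auto simp: sum.distrib sum.delta simp del: index_mult_mat)
qed (use assms in auto)

lemma elem_step_dims:
  assumes "elem_step mul e R A B"
  shows "dim_row B = dim_row A" "dim_col B = dim_col A"
  using assms by (auto simp: elem_step_def Let_def)

text \<open>Transport along a ring embedding lets the same result serve matrices of polynomials,
  which carry the multiplication \<^const>\<open>pmult\<close> instead of a type class one.\<close>

lemma elem_step_mult:
  fixes \<phi> :: "'b::ab_group_add \<Rightarrow> 'c::ring_1"
  assumes step: "elem_step mul e R A B"
    and add: "\<And>x y. \<phi> (x + y) = \<phi> x + \<phi> y"
    and mul: "\<And>x y. \<phi> (mul x y) = \<phi> x * \<phi> y" and one: "\<phi> e = 1"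
    and S: "subring1 (\<phi> ` R)"
  shows "(\<exists>P. unit_over (\<phi> ` R) (dim_row A) P \<and> map_mat \<phi> B = P * map_mat \<phi> A)
    \<or> (\<exists>Q. unit_over (\<phi> ` R) (dim_col A) Q \<and> map_mat \<phi> B = map_mat \<phi> A * Q)"
proof -
  define nr nc A' where "nr = dim_row A" and "nc = dim_col A" and "A' = map_mat \<phi> A"
  have A': "A' \<in> carrier_mat nr nc" by (auto simp: A'_def nr_def nc_def)
  have unit: "is_unit_in (*) 1 (\<phi> ` R) (\<phi> u)" if "is_unit_in mul e R u" for u
    using that mul one unfolding is_unit_in_def by (metis image_eqI)
  consider
    (swapr) i j where "i < nr" "j < nr"
      "B = mat nr nc (\<lambda>(k,l). A $$ (if k = i then j else if k = j then i else k, l))"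
  | (multr) i u where "i < nr" "is_unit_in mul e R u"
      "B = mat nr nc (\<lambda>(k,l). if k = i then mul u (A $$ (k,l)) else A $$ (k,l))"
  | (addr) i j c where "i < nr" "j < nr" "c \<in> R" "i \<noteq> j"
      "B = mat nr nc (\<lambda>(k,l). if k = i then A $$ (i,l) + mul c (A $$ (j,l)) else A $$ (k,l))"
  | (swapc) i j where "i < nc" "j < nc"
      "B = mat nr nc (\<lambda>(k,l). A $$ (k, if l = i then j else if l = j then i else l))"
  | (multc) i u where "i < nc" "is_unit_in mul e R u"
      "B = mat nr nc (\<lambda>(k,l). if l = i then mul (A $$ (k,l)) u else A $$ (k,l))"
  | (addc) i j c where "i < nc" "j < nc" "c \<in> R" "i \<noteq> j"
      "B = mat nr nc (\<lambda>(k,l). if l = i then A $$ (k,i) + mul (A $$ (k,j)) c else A $$ (k,l))"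
    using step unfolding elem_step_def Let_def nr_def[symmetric] nc_def[symmetric]
    apply -
    apply (elim disjE exE conjE bexE)
    by (rule that; assumption)+
  then show ?thesis
    unfolding nr_def[symmetric] nc_def[symmetric] A'_def[symmetric]
  proof cases
    case swapr
    have "map_mat \<phi> B = swaprows i j A'"
      unfolding swapr(3) A'_def using swapr(1,2) by (intro eq_matI) (auto simp: nr_def nc_def)
    also have "\<dots> = swaprows_mat nr i j * A'" using A' swapr by (intro swaprows_mat)
    finally show "(\<exists>P. unit_over (\<phi> ` R) nr P \<and> map_mat \<phi> B = P * A')
        \<or> (\<exists>Q. unit_over (\<phi> ` R) nc Q \<and> map_mat \<phi> B = A' * Q)"
      using unit_over_swaprows_mat[OF S swapr(1,2)] by blast
  next
    case multr
    have "map_mat \<phi> B = multrow i (\<phi> u) A'"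
      unfolding multr(3) A'_def using multr(1,2) by (intro eq_matI) (auto simp: nr_def nc_def mul)
    also have "\<dots> = multrow_mat nr i (\<phi> u) * A'" using A' multr by (intro multrow_mat)
    finally show "(\<exists>P. unit_over (\<phi> ` R) nr P \<and> map_mat \<phi> B = P * A')
        \<or> (\<exists>Q. unit_over (\<phi> ` R) nc Q \<and> map_mat \<phi> B = A' * Q)"
      using unit_over_multrow_mat[OF S unit[OF multr(2)] multr(1)] by blast
  next
    case addr
    have "map_mat \<phi> B = addrow (\<phi> c) i j A'"
      unfolding addr(5) A'_def using addr(1-4)
      by (intro eq_matI) (auto simp: nr_def nc_def mul add add.commute)
    also have "\<dots> = addrow_mat nr (\<phi> c) i j * A'" using A' addr by (intro addrow_mat)
    finally show "(\<exists>P. unit_over (\<phi> ` R) nr P \<and> map_mat \<phi> B = P * A')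
        \<or> (\<exists>Q. unit_over (\<phi> ` R) nc Q \<and> map_mat \<phi> B = A' * Q)"
      using unit_over_addrow_mat[OF S imageI[OF addr(3)] addr(1,2,4)] by blast
  next
    case swapc
    have "map_mat \<phi> B = mat nr nc (\<lambda>(k,l). A' $$ (k, if l = i then j else if l = j then i else l))"
      unfolding swapc(3) A'_def using swapc(1,2) by (intro eq_matI) (auto simp: nr_def nc_def)
    also have "\<dots> = A' * swaprows_mat nc i j" using A' swapc by (intro swapcols_eq_mult)
    finally show "(\<exists>P. unit_over (\<phi> ` R) nr P \<and> map_mat \<phi> B = P * A')
        \<or> (\<exists>Q. unit_over (\<phi> ` R) nc Q \<and> map_mat \<phi> B = A' * Q)"
      using unit_over_swaprows_mat[OF S swapc(1,2)] by blast
  next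
    case multc
    have "map_mat \<phi> B = mat nr nc (\<lambda>(k,l). if l = i then A' $$ (k,l) * \<phi> u else A' $$ (k,l))"
      unfolding multc(3) A'_def using multc(1,2) by (intro eq_matI) (auto simp: nr_def nc_def mul)
    also have "\<dots> = A' * multrow_mat nc i (\<phi> u)" using A' multc by (intro multcol_eq_mult)
    finally show "(\<exists>P. unit_over (\<phi> ` R) nr P \<and> map_mat \<phi> B = P * A')
        \<or> (\<exists>Q. unit_over (\<phi> ` R) nc Q \<and> map_mat \<phi> B = A' * Q)"
      using unit_over_multrow_mat[OF S unit[OF multc(2)] multc(1)] by blast
  next
    case addc
    have "map_mat \<phi> B
        = mat nr nc (\<lambda>(k,l). if l = i then A' $$ (k,i) + A' $$ (k,j) * \<phi> c else A' $$ (k,l))"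
      unfolding addc(5) A'_def using addc(1-4)
      by (intro eq_matI) (auto simp: nr_def nc_def mul add)
    also have "\<dots> = A' * addrow_mat nc (\<phi> c) j i" using A' addc by (intro addcol_eq_mult)
    finally show "(\<exists>P. unit_over (\<phi> ` R) nr P \<and> map_mat \<phi> B = P * A')
        \<or> (\<exists>Q. unit_over (\<phi> ` R) nc Q \<and> map_mat \<phi> B = A' * Q)"
      using unit_over_addrow_mat[OF S imageI[OF addc(3)] addc(2,1) addc(4)[symmetric]] by blast
  qed
qed

text \<open>Every step is multiplication by a unit matrix on one side. The result serves twice: over
  the valuation ring with \<open>\<phi>\<close> the identity, and for polynomial matrices with
  \<open>\<phi>\<close> the embedding into power series.\<close>

lemma elem_reduces_inv_iff:
  fixes \<phi> :: "'b::ab_group_add \<Rightarrow> 'c::ring_1"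
  assumes red: "elem_reduces mul e R A B"
    and add: "\<And>x y. \<phi> (x + y) = \<phi> x + \<phi> y"
    and mul: "\<And>x y. \<phi> (mul x y) = \<phi> x * \<phi> y" and one: "\<phi> e = 1"
    and S: "subring1 (\<phi> ` R)" and I: "bimodule_over (\<phi> ` R) I"
  shows "(left_inv_over I (map_mat \<phi> B) \<longleftrightarrow> left_inv_over I (map_mat \<phi> A))
    \<and> (right_inv_over I (map_mat \<phi> B) \<longleftrightarrow> right_inv_over I (map_mat \<phi> A))
    \<and> dim_row B = dim_row A \<and> dim_col B = dim_col A"
  using red unfolding elem_reduces_def
proof (induction rule: rtranclp_induct)
  case (step B C)
  have B: "map_mat \<phi> B \<in> carrier_mat (dim_row B) (dim_col B)" by auto
  from elem_step_mult[OF step(2) add mul one S]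
  have "(left_inv_over I (map_mat \<phi> C) \<longleftrightarrow> left_inv_over I (map_mat \<phi> B))
    \<and> (right_inv_over I (map_mat \<phi> C) \<longleftrightarrow> right_inv_over I (map_mat \<phi> B))"
    using unit_over_left_iff[OF I _ B] unit_over_right_iff[OF I _ B] by auto
  then show ?case using step(3) elem_step_dims[OF step(2)] by auto
qed auto

section \<open>Diagonal forms over the valuation ring\<close>

text \<open>Clears a whole column at once: the pivot row \<open>p\<close> lies outside
  \<open>K\<close>, so it is unchanged by the single steps and the multiples added are always those
  of the original row.\<close>

lemma elem_reduces_addrows:
  assumes "finite K" "K \<subseteq> {..<dim_row A}" "p < dim_row A" "p \<notin> K" "\<And>k. k \<in> K \<Longrightarrow> c k \<in> R"
  shows "elem_reduces mul e R A (mat (dim_row A) (dim_col A)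
    (\<lambda>(k,l). if k \<in> K then A $$ (k,l) + mul (c k) (A $$ (p,l)) else A $$ (k,l)))"
  using assms
proof (induction K rule: finite_induct)
  case empty
  have "mat (dim_row A) (dim_col A) (\<lambda>(k,l). A $$ (k,l)) = A" by (intro eq_matI) auto
  then show ?case by (simp add: elem_reduces_def)
next
  case (insert i K)
  let ?B = "\<lambda>K. mat (dim_row A) (dim_col A)
    (\<lambda>(k,l). if k \<in> K then A $$ (k,l) + mul (c k) (A $$ (p,l)) else A $$ (k,l))"
  have "elem_reduces mul e R A (?B K)" using insert by auto
  moreover have "elem_step mul e R (?B K) (?B (insert i K))"
    unfolding elem_step_def Let_def
    by (rule disjI2, rule disjI2, rule disjI1, intro exI[of _ i] conjI exI[of _ p] bexI[of _ "c i"])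
      (use insert in \<open>auto intro!: eq_matI\<close>)
  ultimately show ?case by (simp add: elem_reduces_def)
qed

lemma elem_reduces_addcols:
  assumes "finite K" "K \<subseteq> {..<dim_col A}" "p < dim_col A" "p \<notin> K" "\<And>k. k \<in> K \<Longrightarrow> c k \<in> R"
  shows "elem_reduces mul e R A (mat (dim_row A) (dim_col A)
    (\<lambda>(k,l). if l \<in> K then A $$ (k,l) + mul (A $$ (k,p)) (c l) else A $$ (k,l)))"
  using assms
proof (induction K rule: finite_induct)
  case empty
  have "mat (dim_row A) (dim_col A) (\<lambda>(k,l). A $$ (k,l)) = A" by (intro eq_matI) auto
  then show ?case by (simp add: elem_reduces_def)
next
  case (insert i K)
  let ?B = "\<lambda>K. mat (dim_row A) (dim_col A)
    (\<lambda>(k,l). if l \<in> K then A $$ (k,l) + mul (A $$ (k,p)) (c l) else A $$ (k,l))"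
  have "elem_reduces mul e R A (?B K)" using insert by auto
  moreover have "elem_step mul e R (?B K) (?B (insert i K))"
    unfolding elem_step_def Let_def
    by (rule disjI2, rule disjI2, rule disjI2, rule disjI2, rule disjI2, intro exI[of _ i] conjI exI[of _ p] bexI[of _ "c i"])
      (use insert in \<open>auto intro!: eq_matI\<close>)
  ultimately show ?case by (simp add: elem_reduces_def)
qed

lemma card_less_and_eq_iff:
  assumes "k \<le> (d::nat)" shows "card {i. i < k \<and> P i} = d \<longleftrightarrow> k = d \<and> (\<forall>i<d. P i)"
proof
  assume *: "card {i. i < k \<and> P i} = d"
  have "card {i. i < k \<and> P i} \<le> card {..<k}" by (intro card_mono) auto
  with * assms have "k = d" by simp
  moreover have "{i. i < k \<and> P i} = {..<k}"
    using * \<open>k = d\<close> by (intro card_subset_eq) auto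
  ultimately show "k = d \<and> (\<forall>i<d. P i)" by auto
next
  assume "k = d \<and> (\<forall>i<d. P i)"
  then have "{i. i < k \<and> P i} = {..<d}" by auto
  then show "card {i. i < k \<and> P i} = d" by simp
qed

locale valued_skew_field =
  fixes v :: "'a::division_ring \<Rightarrow> int" and \<sigma> :: 'a
  assumes v_mult: "x \<noteq> 0 \<Longrightarrow> y \<noteq> 0 \<Longrightarrow> v (x * y) = v x + v y"
    and v_add: "x \<noteq> 0 \<Longrightarrow> y \<noteq> 0 \<Longrightarrow> x + y \<noteq> 0 \<Longrightarrow> min (v x) (v y) \<le> v (x + y)"
    and \<sigma>_nz [simp]: "\<sigma> \<noteq> 0" and v_\<sigma> [simp]: "v \<sigma> = 1"
begin

lemma v_one [simp]: "v 1 = 0"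
  using v_mult[of 1 1] by simp

lemma v_minus [simp]: "v (- x) = v x"
proof (cases "x = 0")
  case False
  have "v (- 1) = 0" using v_mult[of "- 1" "- 1"] by simp
  then show ?thesis using v_mult[of "- 1" x] False by simp
qed auto

lemma v_inverse: "x \<noteq> 0 \<Longrightarrow> v (inverse x) = - v x"
  using v_mult[of x "inverse x"] by simp

lemma v_\<sigma>_power [simp]: "v (\<sigma> ^ n) = int n"
  by (induction n) (auto simp: v_mult)

lemma val_ge_zero [simp]: "val_ge v 0 k"
  by (simp add: val_ge_def)

lemma val_ge_mono: "val_ge v x k \<Longrightarrow> l \<le> k \<Longrightarrow> val_ge v x l"
  by (auto simp: val_ge_def)

lemma val_ge_minus [simp]: "val_ge v (- x) k \<longleftrightarrow> val_ge v x k"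
  by (auto simp: val_ge_def)

lemma val_ge_add: "val_ge v x k \<Longrightarrow> val_ge v y k \<Longrightarrow> val_ge v (x + y) k"
  using v_add[of x y]
  by (cases "x = 0"; cases "y = 0"; cases "x + y = 0") (auto simp: val_ge_def min_le_iff_disj)

lemma val_ge_mult: "val_ge v x k \<Longrightarrow> val_ge v y l \<Longrightarrow> val_ge v (x * y) (k + l)"
  using v_mult[of x y] by (cases "x = 0"; cases "y = 0") (auto simp: val_ge_def)

lemma val_ge_sum: "(\<And>i. i \<in> S \<Longrightarrow> val_ge v (f i) k) \<Longrightarrow> val_ge v (sum f S) k"
  by (induction S rule: infinite_finite_induct) (auto intro: val_ge_add)

lemma subring1_val_ring: "subring1 (val_ring v)"
  using val_ge_add[of _ 0] val_ge_mult[of _ 0 _ 0] by (auto simp: subring1_def val_ring_def val_ge_def[of v 1])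

lemma bimodule_over_val_ge: "bimodule_over (val_ring v) {x. val_ge v x k}"
  using val_ge_add[of _ k] val_ge_mult[of _ 0 _ k] val_ge_mult[of _ k _ 0]
  by (auto simp: bimodule_over_def val_ring_def)

lemma is_unit_in_val_ring: "u \<noteq> 0 \<Longrightarrow> v u = 0 \<Longrightarrow> is_unit_in (*) 1 (val_ring v) u"
  unfolding is_unit_in_def
  by (intro conjI bexI[of _ "inverse u"]) (auto simp: val_ring_def val_ge_def v_inverse)

section \<open>Elimination over the valuation ring\<close>

abbreviation O_reduces :: "'a mat \<Rightarrow> 'a mat \<Rightarrow> bool" where
  "O_reduces \<equiv> elem_reduces (*) 1 (val_ring v)"

text \<open>Invariant of the elimination: the first \<open>p\<close> rows and columns are finished.
  The number \<open>e\<close> bounds the exponents found so far from above and the valuations in the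
  unfinished block from below, which makes the final exponents increase.\<close>

definition diag_upto :: "nat \<Rightarrow> (nat \<Rightarrow> nat) \<Rightarrow> nat \<Rightarrow> 'a mat \<Rightarrow> bool" where
  "diag_upto p \<nu> e A \<longleftrightarrow> p \<le> min (dim_row A) (dim_col A)
    \<and> (\<forall>i<dim_row A. \<forall>j<dim_col A. i \<noteq> j \<longrightarrow> i < p \<or> j < p \<longrightarrow> A $$ (i,j) = 0)
    \<and> (\<forall>i<p. A $$ (i,i) = \<sigma> ^ \<nu> i \<and> \<nu> i \<le> e)
    \<and> (\<forall>i j. i \<le> j \<longrightarrow> j < p \<longrightarrow> \<nu> i \<le> \<nu> j)
    \<and> (\<forall>i<dim_row A. \<forall>j<dim_col A. p \<le> i \<longrightarrow> p \<le> j \<longrightarrow> val_ge v (A $$ (i,j)) (int e))"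

text \<open>An entry of least valuation in the unfinished block is swapped to \<open>(p,p)\<close>
  and normalised to a power of \<open>\<sigma>\<close>. Its valuation \<open>N\<close> is at least
  \<open>e\<close> and becomes the new bound.\<close>

lemma diag_upto_pivot:
  assumes A: "diag_upto p \<nu> e A"
    and nz: "i0 < dim_row A" "j0 < dim_col A" "p \<le> i0" "p \<le> j0" "A $$ (i0,j0) \<noteq> 0"
  obtains B N where "O_reduces A B" "diag_upto p \<nu> N B" "p < dim_row B" "p < dim_col B"
    "B $$ (p,p) = \<sigma> ^ N"
proof -
  define nr nc where "nr = dim_row A" and "nc = dim_col A"
  define S where "S = {(i,j). i < nr \<and> j < nc \<and> p \<le> i \<and> p \<le> j \<and> A $$ (i,j) \<noteq> 0}"
  have "S \<subseteq> {..<nr} \<times> {..<nc}" by (auto simp: S_def)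
  then have "finite S" by (rule finite_subset) auto
  moreover have "(i0,j0) \<in> S" using nz by (auto simp: S_def nr_def nc_def)
  ultimately obtain q where q: "q \<in> S" "\<And>y. y \<in> S \<Longrightarrow> v (A $$ q) \<le> v (A $$ y)"
    using arg_min_if_finite[of S "\<lambda>q. v (A $$ q)"] by (metis empty_iff linorder_not_less)
  obtain i1 j1 where ij: "q = (i1,j1)" by (cases q)
  define a where "a = A $$ (i1,j1)"
  have i1: "i1 < nr" "j1 < nc" "p \<le> i1" "p \<le> j1" "a \<noteq> 0" using q(1) by (auto simp: S_def ij a_def)
  have minv: "val_ge v (A $$ (i,j)) (v a)" if "i < nr" "j < nc" "p \<le> i" "p \<le> j" for i j
    using q(2)[of "(i,j)"] that by (auto simp: S_def val_ge_def a_def ij)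
  have ev: "int e \<le> v a"
    using A i1 unfolding diag_upto_def val_ge_def a_def nr_def nc_def by auto
  define N where "N = nat (v a)"
  have N: "int N = v a" "e \<le> N" using ev by (auto simp: N_def)
  \<comment> \<open>\<open>\<rho> t\<close> is the transposition of \<open>p\<close> and
    \<open>t\<close>, used with \<open>i1\<close> for rows and with \<open>j1\<close> for
    columns.\<close>
  define \<rho> where "\<rho> = (\<lambda>t k. if k = p then t else if k = t then p else k :: nat)"
  \<comment> \<open>The pivot has valuation \<open>N\<close>, so \<open>u\<close> has valuation 0
    and is a unit; it divides on the right because scaling a row multiplies from the left.\<close>
  define u where "u = \<sigma> ^ N * inverse a"
  have u: "u \<noteq> 0" "v u = 0" "u * a = \<sigma> ^ N"
    using i1(5) N by (auto simp: u_def v_mult v_inverse mult.assoc)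
  define A1 where "A1 = mat nr nc (\<lambda>(k,l). A $$ (\<rho> i1 k, l))"
  define A2 where "A2 = mat nr nc (\<lambda>(k,l). A1 $$ (k, \<rho> j1 l))"
  define A3 where "A3 = mat nr nc (\<lambda>(k,l). if k = p then u * A2 $$ (k,l) else A2 $$ (k,l))"
  have dims: "dim_row A1 = nr" "dim_col A1 = nc" "dim_row A2 = nr" "dim_col A2 = nc"
    "dim_row A3 = nr" "dim_col A3 = nc"
    by (auto simp: A1_def A2_def A3_def)
  have p: "p < nr" "p < nc" using i1 by auto
  have \<rho>_lt: "\<rho> i1 k < nr" if "k < nr" for k using that i1 p by (auto simp: \<rho>_def)
  have \<rho>_lt': "\<rho> j1 k < nc" if "k < nc" for k using that i1 p by (auto simp: \<rho>_def)
  have \<rho>_id: "\<rho> t k = k" if "k < p" "p \<le> t" for t k using that by (auto simp: \<rho>_def)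
  have \<rho>_ge: "p \<le> \<rho> t k" if "p \<le> k" "p \<le> t" for t k using that by (auto simp: \<rho>_def)
  have "elem_step (*) 1 (val_ring v) A A1"
    unfolding elem_step_def Let_def nr_def[symmetric] nc_def[symmetric] A1_def \<rho>_def
    by (rule disjI1, rule exI[of _ p], rule conjI[OF p(1)], rule exI[of _ i1]) (use i1 in auto)
  moreover have "elem_step (*) 1 (val_ring v) A1 A2"
    unfolding elem_step_def Let_def dims A2_def \<rho>_def
    by (rule disjI2, rule disjI2, rule disjI2, rule disjI1, rule exI[of _ p], rule conjI[OF p(2)],
        rule exI[of _ j1]) (use i1 in auto)
  moreover have "elem_step (*) 1 (val_ring v) A2 A3"
    unfolding elem_step_def Let_def dims A3_def
    by (rule disjI2, rule disjI1) (use p is_unit_in_val_ring[OF u(1,2)] in auto)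
  ultimately have red: "O_reduces A A3" by (simp add: elem_reduces_def)
  have ent: "A3 $$ (k,l) = (if k = p then u * A $$ (\<rho> i1 k, \<rho> j1 l) else A $$ (\<rho> i1 k, \<rho> j1 l))"
    if "k < nr" "l < nc" for k l
    using that \<rho>_lt' by (auto simp: A3_def A2_def A1_def)
  have zero: "A $$ (i,j) = 0" if "i < nr" "j < nc" "i \<noteq> j" "i < p \<or> j < p" for i j
    using A that by (auto simp: diag_upto_def nr_def nc_def)
  have "diag_upto p \<nu> N A3"
    unfolding diag_upto_def dims
  proof (intro conjI allI impI)
    show "p \<le> min nr nc" using p by auto
  next
    fix i j assume *: "i < nr" "j < nc" "i \<noteq> j" "i < p \<or> j < p"
    then have "\<rho> i1 i \<noteq> \<rho> j1 j" using i1 by (auto simp: \<rho>_def)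
    moreover have "\<rho> i1 i < p \<or> \<rho> j1 j < p" using * i1 \<rho>_id by auto
    ultimately show "A3 $$ (i,j) = 0" using * zero \<rho>_lt \<rho>_lt' by (auto simp: ent)
  next
    fix i assume "i < p"
    then show "A3 $$ (i,i) = \<sigma> ^ \<nu> i" "\<nu> i \<le> N"
      using A p i1 \<rho>_id N by (fastforce simp: ent diag_upto_def)+
  next
    fix i j assume "i \<le> j" "j < p"
    then show "\<nu> i \<le> \<nu> j" using A by (auto simp: diag_upto_def)
  next
    fix i j assume "i < nr" "j < nc" "p \<le> i" "p \<le> j"
    moreover from this have "val_ge v (A $$ (\<rho> i1 i, \<rho> j1 j)) (int N)"
      unfolding N(1) using \<rho>_lt \<rho>_lt' \<rho>_ge i1 by (intro minv) auto
    moreover have "val_ge v u 0" using u by (simp add: val_ge_def)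
    ultimately show "val_ge v (A3 $$ (i,j)) (int N)"
      using val_ge_mult[of u 0] by (auto simp: ent)
  qed
  moreover have "A3 $$ (p,p) = \<sigma> ^ N"
    using p u(3) by (simp add: ent \<rho>_def a_def)
  ultimately show ?thesis using that red p dims by metis
qed

text \<open>The pivot has least valuation in the unfinished block, so all multipliers are integral.
  Since entries do not commute, row multipliers divide by the pivot on the right and column
  multipliers on the left.\<close>

lemma diag_upto_clear:
  assumes A: "diag_upto p \<nu> N A" "p < dim_row A" "p < dim_col A" "A $$ (p,p) = \<sigma> ^ N"
  obtains B where "O_reduces A B" "diag_upto (Suc p) (\<nu>(p := N)) N B"
    "dim_row B = dim_row A" "dim_col B = dim_col A"
proof -
  define nr nc where "nr = dim_row A" and "nc = dim_col A"
  define s where "s = \<sigma> ^ N"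
  have s: "s \<noteq> 0" "v s = int N" by (auto simp: s_def)
  have App: "A $$ (p,p) = s" using A by (simp add: s_def)
  have p: "p < nr" "p < nc" using A by (auto simp: nr_def nc_def)
  have zero: "A $$ (i,j) = 0" if "i < nr" "j < nc" "i \<noteq> j" "i < p \<or> j < p" for i j
    using A that by (auto simp: diag_upto_def nr_def nc_def)
  have valA: "val_ge v (A $$ (i,j)) (int N)" if "i < nr" "j < nc" "p \<le> i" "p \<le> j" for i j
    using A that by (auto simp: diag_upto_def nr_def nc_def)
  have diag: "A $$ (i,i) = \<sigma> ^ \<nu> i" "\<nu> i \<le> N" if "i < p" for i
    using A that by (auto simp: diag_upto_def)
  define c where "c = (\<lambda>k. - (A $$ (k,p) * inverse s))"
  define f where "f = (\<lambda>l. - (inverse s * A $$ (p,l)))"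
  have cf: "c k \<in> val_ring v" if "k < nr" "p < k" for k
    using that p val_ge_mult[OF valA, of k p "inverse s" "- int N"] s
    by (auto simp: val_ring_def c_def val_ge_def[of v "inverse s"] v_inverse)
  have ff: "f l \<in> val_ring v" if "l < nc" "p < l" for l
    using that p val_ge_mult[OF _ valA, of "inverse s" "- int N" p l] s
    by (auto simp: val_ring_def f_def val_ge_def[of v "inverse s"] v_inverse)
  define A1 where "A1 = mat nr nc
    (\<lambda>(k,l). if k \<in> {p<..<nr} then A $$ (k,l) + c k * (A $$ (p,l)) else A $$ (k,l))"
  define A2 where "A2 = mat nr nc
    (\<lambda>(k,l). if l \<in> {p<..<nc} then A1 $$ (k,l) + A1 $$ (k,p) * f l else A1 $$ (k,l))"
  have dims: "dim_row A1 = nr" "dim_col A1 = nc" "dim_row A2 = nr" "dim_col A2 = nc"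
    by (auto simp: A1_def A2_def)
  have "O_reduces A A1" unfolding A1_def nr_def nc_def
    by (rule elem_reduces_addrows) (use p cf in \<open>auto simp: nr_def nc_def\<close>)
  moreover have "O_reduces A1 A2" unfolding A2_def dims(1,2)[symmetric]
    by (rule elem_reduces_addcols) (use p ff in \<open>auto simp: dims\<close>)
  ultimately have red: "O_reduces A A2" by (simp add: elem_reduces_def)
  have A1col: "A1 $$ (k,p) = (if k = p then s else 0)" if "k < nr" for k
    using that p zero[of k p] s by (auto simp: A1_def c_def App mult.assoc)
  have A1row: "A1 $$ (k,l) = A $$ (k,l)" if "k \<le> p" "l < nc" for k l
    using that p by (auto simp: A1_def)
  have A1ge: "A1 $$ (k,l) = A $$ (k,l) + c k * A $$ (p,l)" if "p < k" "k < nr" "l < nc" for k l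
    using that p by (auto simp: A1_def)
  have A2p: "A2 $$ (p,l) = (if l = p then s else 0)" if "l < nc" for l
    using that p A1col[of p] A1row[of p] zero[of p l] s
    by (auto simp: A2_def f_def App mult.assoc[symmetric])
  \<comment> \<open>The row operations have already emptied column \<open>p\<close> outside the
    pivot, so the column operations change row \<open>p\<close> only.\<close>
  have A2k: "A2 $$ (k,l) = A1 $$ (k,l)" if "k \<noteq> p" "k < nr" "l < nc" for k l
    using that A1col[of k] by (auto simp: A2_def)
  have "diag_upto (Suc p) (\<nu>(p := N)) N A2"
    unfolding diag_upto_def dims
  proof (intro conjI allI impI)
    show "Suc p \<le> min nr nc" using p by auto
  next
    fix i j assume *: "i < nr" "j < nc" "i \<noteq> j" "i < Suc p \<or> j < Suc p"
    then consider "i = p" | "i \<noteq> p" "j = p" | "i < p" | "p < i" "j < p" by force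
    then show "A2 $$ (i,j) = 0"
    proof cases
      case 4
      then show ?thesis using * p zero[of i j] zero[of p j] by (auto simp: A2k A1ge)
    qed (use * A2p A2k A1col A1row zero[of i j] in auto)
  next
    fix i assume "i < Suc p"
    then show "A2 $$ (i,i) = \<sigma> ^ (\<nu>(p := N)) i" "(\<nu>(p := N)) i \<le> N"
      using p diag A2p A2k A1row by (auto simp: s_def less_Suc_eq)
  next
    fix i j assume "i \<le> j" "j < Suc p"
    then show "(\<nu>(p := N)) i \<le> (\<nu>(p := N)) j" using A diag(2)
      by (auto simp: diag_upto_def less_Suc_eq)
  next
    fix i j assume *: "i < nr" "j < nc" "Suc p \<le> i" "Suc p \<le> j"
    have "val_ge v (c i * A $$ (p,j)) (0 + int N)"
      using * p cf by (intro val_ge_mult valA) (auto simp: val_ring_def)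
    then show "val_ge v (A2 $$ (i,j)) (int N)"
      using * valA by (auto simp: A2k A1ge intro!: val_ge_add)
  qed
  then show ?thesis using that red dims by (simp add: nr_def nc_def)
qed

text \<open>Each pivot reduces the number of unfinished rows. Once the unfinished block vanishes,
  the invariant is the desired form with \<open>k = p\<close>.\<close>

lemma diag_upto_imp_diag_form:
  assumes "diag_upto p \<nu> e A"
  shows "\<exists>B k \<nu>. O_reduces A B \<and> sigma_diag_form \<sigma> B k \<nu>"
  using assms
proof (induction "dim_row A - p" arbitrary: p \<nu> e A rule: less_induct)
  case less
  show ?case
  proof (cases "\<exists>i<dim_row A. \<exists>j<dim_col A. p \<le> i \<and> p \<le> j \<and> A $$ (i,j) \<noteq> 0")
    case True
    then obtain i j where ij: "i < dim_row A" "j < dim_col A" "p \<le> i" "p \<le> j" "A $$ (i,j) \<noteq> 0" by auto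
    obtain B N where B: "O_reduces A B" "diag_upto p \<nu> N B" "p < dim_row B" "p < dim_col B"
      "B $$ (p,p) = \<sigma> ^ N"
      using diag_upto_pivot[OF less.prems ij] by blast
    have dB: "dim_row B = dim_row A"
      using B(1) unfolding elem_reduces_def by (induction rule: rtranclp_induct) (auto simp: elem_step_dims)
    obtain C where C: "O_reduces B C" "diag_upto (Suc p) (\<nu>(p := N)) N C" "dim_row C = dim_row B"
      using diag_upto_clear[OF B(2-5)] by blast
    obtain E k \<mu> where "O_reduces C E" "sigma_diag_form \<sigma> E k \<mu>"
      using less.hyps[OF _ C(2)] B(3) C(3) dB by (metis diff_less_mono2 lessI)
    then show ?thesis using B(1) C(1) unfolding elem_reduces_def by (meson rtranclp_trans)
  next
    case False
    then have "A $$ (i,j) = 0" if "p \<le> i" "p \<le> j" "i < dim_row A" "j < dim_col A" for i j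
      using that by blast
    then have "sigma_diag_form \<sigma> A p \<nu>"
      using less.prems unfolding sigma_diag_form_def diag_upto_def
      by (auto simp: not_less) (metis linorder_not_less)
    then show ?thesis unfolding elem_reduces_def by blast
  qed
qed

lemma diag_form_exists:
  assumes "mat_over (val_ring v) A"
  obtains B k \<nu> where "O_reduces A B" "sigma_diag_form \<sigma> B k \<nu>"
proof -
  have "diag_upto 0 (\<lambda>_. 0) 0 A"
    using assms by (auto simp: diag_upto_def mat_over_def val_ring_def)
  then show ?thesis using diag_upto_imp_diag_form that by blast
qed

section \<open>Rank modulo a power of \<open>\<sigma>\<close> through one-sided inverses\<close>

lemma O_reduces_inv_iff:
  assumes "O_reduces A B" "bimodule_over (val_ring v) I"
  shows "left_inv_over I B \<longleftrightarrow> left_inv_over I A" "right_inv_over I B \<longleftrightarrow> right_inv_over I A"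
    "dim_row B = dim_row A" "dim_col B = dim_col A"
proof -
  have "map_mat (\<lambda>x. x) C = C" for C :: "'a mat" by (intro eq_matI) auto
  then show "left_inv_over I B \<longleftrightarrow> left_inv_over I A" "right_inv_over I B \<longleftrightarrow> right_inv_over I A"
    "dim_row B = dim_row A" "dim_col B = dim_col A"
    using elem_reduces_inv_iff[OF assms(1), of "\<lambda>x. x" I] assms(2) subring1_val_ring by auto
qed

text \<open>The diagonal shape gives \<open>C $$ (i,i) * \<sigma> ^ \<nu> i = 1\<close>, so the
  valuation of \<open>C $$ (i,i)\<close> is \<open>- \<nu> i\<close>, which is at least
  \<open>1 - s\<close> exactly when \<open>\<nu> i < s\<close>. A zero column admits no left
  inverse; this forces \<open>k = dim_col B\<close>.\<close>

lemma sigma_diag_left_inv_iff: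
  assumes B: "sigma_diag_form \<sigma> B k \<nu>"
  shows "left_inv_over {x. val_ge v x (1 - int s)} B \<longleftrightarrow> k = dim_col B \<and> (\<forall>i<k. \<nu> i < s)"
proof
  assume "left_inv_over {x. val_ge v x (1 - int s)} B"
  then obtain C where C: "C \<in> carrier_mat (dim_col B) (dim_row B)"
    "mat_over {x. val_ge v x (1 - int s)} C" "C * B = 1\<^sub>m (dim_col B)"
    unfolding left_inv_over_def by auto
  have CB: "C $$ (i,i) * B $$ (i,i) = 1" if "i < dim_row B" "i < dim_col B" for i
  proof -
    have "(C * B) $$ (i,i) = (\<Sum>l<dim_row B. C $$ (i,l) * B $$ (l,i))"
      using that by (intro mat_index_mult_sum[OF C(1), of _ "dim_col B"]) auto
    also have "\<dots> = (\<Sum>l<dim_row B. if l = i then C $$ (i,i) * B $$ (i,i) else 0)"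
      using B that by (intro sum.cong) (auto simp: sigma_diag_form_def)
    also have "\<dots> = C $$ (i,i) * B $$ (i,i)" using that by simp
    finally show ?thesis using C(3) that by simp
  qed
  have "dim_col B \<le> dim_row B"
  proof (rule ccontr)
    assume "\<not> dim_col B \<le> dim_row B"
    then have i: "dim_row B < dim_col B" by simp
    have "(C * B) $$ (dim_row B, dim_row B) = (\<Sum>l<dim_row B. C $$ (dim_row B,l) * B $$ (l,dim_row B))"
      using i by (intro mat_index_mult_sum[OF C(1), of _ "dim_col B"]) auto
    also have "\<dots> = 0" using B i by (intro sum.neutral) (auto simp: sigma_diag_form_def)
    finally show False using C(3) i by simp
  qed
  moreover have "k = dim_col B"
  proof (rule ccontr)
    assume "k \<noteq> dim_col B"
    with B calculation have "k < dim_col B" "k < dim_row B" "B $$ (k,k) = 0"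
      by (auto simp: sigma_diag_form_def)
    with CB[of k] show False by simp
  qed
  moreover have "\<nu> i < s" if "i < k" for i
  proof -
    have i: "i < dim_row B" "i < dim_col B" using that calculation by auto
    have "B $$ (i,i) = \<sigma> ^ \<nu> i" using B that by (auto simp: sigma_diag_form_def)
    with CB[OF i] have *: "C $$ (i,i) * \<sigma> ^ \<nu> i = 1" by simp
    then have nz: "C $$ (i,i) \<noteq> 0" by auto
    have "v (C $$ (i,i)) + int (\<nu> i) = 0" using v_mult[OF nz, of "\<sigma> ^ \<nu> i"] * by simp
    moreover have "1 - int s \<le> v (C $$ (i,i))"
      using C(1,2) i nz by (auto simp: mat_over_def val_ge_def)
    ultimately show ?thesis by simp
  qed
  ultimately show "k = dim_col B \<and> (\<forall>i<k. \<nu> i < s)" by auto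
next
  assume *: "k = dim_col B \<and> (\<forall>i<k. \<nu> i < s)"
  define C where "C = mat (dim_col B) (dim_row B) (\<lambda>(i,j). if i = j then inverse (\<sigma> ^ \<nu> i) else 0)"
  have "C * B = 1\<^sub>m (dim_col B)"
  proof (rule eq_matI, goal_cases)
    case (1 i j)
    then have ij: "i < dim_col B" "j < dim_col B" "i < dim_row B"
      using * B by (auto simp: sigma_diag_form_def)
    have "(C * B) $$ (i,j) = (\<Sum>l<dim_row B. C $$ (i,l) * B $$ (l,j))"
      using ij by (intro mat_index_mult_sum[of _ "dim_col B" _ _ "dim_col B"]) (auto simp: C_def)
    also have "\<dots> = (\<Sum>l<dim_row B. if l = i then inverse (\<sigma> ^ \<nu> i) * B $$ (i,j) else 0)"
      using ij by (intro sum.cong) (auto simp: C_def)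
    also have "\<dots> = inverse (\<sigma> ^ \<nu> i) * B $$ (i,j)" using ij by simp
    finally show ?case using ij * B by (auto simp: sigma_diag_form_def)
  qed (auto simp: C_def)
  moreover have "mat_over {x. val_ge v x (1 - int s)} C"
    using * by (auto simp: C_def mat_over_def val_ge_def v_inverse)
  ultimately show "left_inv_over {x. val_ge v x (1 - int s)} B"
    unfolding left_inv_over_def by (auto simp: C_def intro!: bexI[of _ C])
qed

lemma sigma_diag_right_inv_iff:
  assumes B: "sigma_diag_form \<sigma> B k \<nu>"
  shows "right_inv_over {x. val_ge v x (1 - int s)} B \<longleftrightarrow> k = dim_row B \<and> (\<forall>i<k. \<nu> i < s)"
proof
  assume "right_inv_over {x. val_ge v x (1 - int s)} B"
  then obtain C where C: "C \<in> carrier_mat (dim_col B) (dim_row B)"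
    "mat_over {x. val_ge v x (1 - int s)} C" "B * C = 1\<^sub>m (dim_row B)"
    unfolding right_inv_over_def by auto
  have CB: "B $$ (i,i) * C $$ (i,i) = 1" if "i < dim_row B" "i < dim_col B" for i
  proof -
    have "(B * C) $$ (i,i) = (\<Sum>l<dim_col B. B $$ (i,l) * C $$ (l,i))"
      using that by (intro mat_index_mult_sum[OF _ C(1), of _ "dim_row B"]) auto
    also have "\<dots> = (\<Sum>l<dim_col B. if l = i then B $$ (i,i) * C $$ (i,i) else 0)"
      using B that by (intro sum.cong) (auto simp: sigma_diag_form_def)
    also have "\<dots> = B $$ (i,i) * C $$ (i,i)" using that by simp
    finally show ?thesis using C(3) that by simp
  qed
  have "dim_row B \<le> dim_col B"
  proof (rule ccontr)
    assume "\<not> dim_row B \<le> dim_col B"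
    then have i: "dim_col B < dim_row B" by simp
    have "(B * C) $$ (dim_col B, dim_col B) = (\<Sum>l<dim_col B. B $$ (dim_col B,l) * C $$ (l,dim_col B))"
      using i by (intro mat_index_mult_sum[OF _ C(1), of _ "dim_row B"]) auto
    also have "\<dots> = 0" using B i by (intro sum.neutral) (auto simp: sigma_diag_form_def)
    finally show False using C(3) i by simp
  qed
  moreover have "k = dim_row B"
  proof (rule ccontr)
    assume "k \<noteq> dim_row B"
    with B calculation have "k < dim_col B" "k < dim_row B" "B $$ (k,k) = 0"
      by (auto simp: sigma_diag_form_def)
    with CB[of k] show False by simp
  qed
  moreover have "\<nu> i < s" if "i < k" for i
  proof -
    have i: "i < dim_row B" "i < dim_col B" using that calculation by auto
    have "B $$ (i,i) = \<sigma> ^ \<nu> i" using B that by (auto simp: sigma_diag_form_def)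
    with CB[OF i] have *: "\<sigma> ^ \<nu> i * C $$ (i,i) = 1" by simp
    then have nz: "C $$ (i,i) \<noteq> 0" by auto
    have "int (\<nu> i) + v (C $$ (i,i)) = 0" using v_mult[OF _ nz, of "\<sigma> ^ \<nu> i"] * by simp
    moreover have "1 - int s \<le> v (C $$ (i,i))"
      using C(1,2) i nz by (auto simp: mat_over_def val_ge_def)
    ultimately show ?thesis by simp
  qed
  ultimately show "k = dim_row B \<and> (\<forall>i<k. \<nu> i < s)" by auto
next
  assume *: "k = dim_row B \<and> (\<forall>i<k. \<nu> i < s)"
  define C where "C = mat (dim_col B) (dim_row B) (\<lambda>(i,j). if i = j then inverse (\<sigma> ^ \<nu> i) else 0)"
  have "B * C = 1\<^sub>m (dim_row B)"
  proof (rule eq_matI, goal_cases)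
    case (1 i j)
    then have ij: "i < dim_row B" "j < dim_row B" "j < dim_col B"
      using * B by (auto simp: sigma_diag_form_def)
    have "(B * C) $$ (i,j) = (\<Sum>l<dim_col B. B $$ (i,l) * C $$ (l,j))"
      using ij by (intro mat_index_mult_sum[of _ "dim_row B" _ _ "dim_row B"]) (auto simp: C_def)
    also have "\<dots> = (\<Sum>l<dim_col B. if l = j then B $$ (i,j) * inverse (\<sigma> ^ \<nu> j) else 0)"
      using ij by (intro sum.cong) (auto simp: C_def)
    also have "\<dots> = B $$ (i,j) * inverse (\<sigma> ^ \<nu> j)" using ij by simp
    finally show ?case using ij * B by (auto simp: sigma_diag_form_def)
  qed (auto simp: C_def)
  moreover have "mat_over {x. val_ge v x (1 - int s)} C"
    using * by (auto simp: C_def mat_over_def val_ge_def v_inverse)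
  ultimately show "right_inv_over {x. val_ge v x (1 - int s)} B"
    unfolding right_inv_over_def by (auto simp: C_def intro!: bexI[of _ C])
qed

text \<open>Left invertibility over \<open>{x. val_ge v x (1 - int s)}\<close> is shared by
  \<open>A\<close> and all its diagonal forms, so every form gives the same answer to whether the
  rank is full. Integrality of \<open>A\<close> ensures that a form exists.\<close>

lemma rank_mod_iff_left_inv:
  assumes "mat_over (val_ring v) A"
  shows "rank_mod v \<sigma> s A (dim_col A) \<longleftrightarrow> left_inv_over {x. val_ge v x (1 - int s)} A"
proof -
  note red = O_reduces_inv_iff[OF _ bimodule_over_val_ge]
  have *: "card {i. i < k \<and> \<nu> i < s} = dim_col A \<longleftrightarrow> left_inv_over {x. val_ge v x (1 - int s)} A"
    if "O_reduces A B" "sigma_diag_form \<sigma> B k \<nu>" for B k \<nu>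
  proof -
    have "k \<le> dim_col A" using that(2) red(4)[OF that(1)] by (auto simp: sigma_diag_form_def)
    from card_less_and_eq_iff[OF this, of "\<lambda>i. \<nu> i < s"] show ?thesis
      using sigma_diag_left_inv_iff[OF that(2), of s] red(1)[OF that(1)] red(4)[OF that(1)] by auto
  qed
  obtain B k \<nu> where "O_reduces A B" "sigma_diag_form \<sigma> B k \<nu>" using diag_form_exists[OF assms] .
  with * show ?thesis unfolding rank_mod_def by blast
qed

lemma rank_mod_iff_right_inv:
  assumes "mat_over (val_ring v) A"
  shows "rank_mod v \<sigma> s A (dim_row A) \<longleftrightarrow> right_inv_over {x. val_ge v x (1 - int s)} A"
proof -
  note red = O_reduces_inv_iff[OF _ bimodule_over_val_ge]
  have *: "card {i. i < k \<and> \<nu> i < s} = dim_row A \<longleftrightarrow> right_inv_over {x. val_ge v x (1 - int s)} A"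
    if "O_reduces A B" "sigma_diag_form \<sigma> B k \<nu>" for B k \<nu>
  proof -
    have "k \<le> dim_row A" using that(2) red(3)[OF that(1)] by (auto simp: sigma_diag_form_def)
    from card_less_and_eq_iff[OF this, of "\<lambda>i. \<nu> i < s"] show ?thesis
      using sigma_diag_right_inv_iff[OF that(2), of s] red(2)[OF that(1)] red(3)[OF that(1)] by auto
  qed
  obtain B k \<nu> where "O_reduces A B" "sigma_diag_form \<sigma> B k \<nu>" using diag_form_exists[OF assms] .
  with * show ?thesis unfolding rank_mod_def by blast
qed

end

section \<open>Rank conditions and topological nilpotence of the inverse\<close>

lemma pow_mat_add:
  assumes "A \<in> carrier_mat d d"
  shows "A ^\<^sub>m (a + b) = A ^\<^sub>m a * A ^\<^sub>m b"
proof (induction b)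
  case (Suc b)
  then show ?case using assms by (simp add: assoc_mult_mat[of _ d d _ d _ d])
qed (use assms in auto)

lemma pow_mat_mult_inverse:
  assumes A: "A \<in> carrier_mat d d" and B: "B \<in> carrier_mat d d" and inv: "A * B = 1\<^sub>m d"
  shows "A ^\<^sub>m a * B ^\<^sub>m a = 1\<^sub>m d"
proof (induction a)
  case (Suc a)
  have "B ^\<^sub>m Suc a = B * B ^\<^sub>m a" using pow_mat_add[OF B, of 1 a] B by simp
  then have "A ^\<^sub>m Suc a * B ^\<^sub>m Suc a = A ^\<^sub>m a * (A * (B * B ^\<^sub>m a))"
    using A B by (simp add: assoc_mult_mat[of _ d d _ d _ d])
  also have "A * (B * B ^\<^sub>m a) = B ^\<^sub>m a"
    using assoc_mult_mat[OF A B pow_carrier_mat[OF B, of a]] inv B by simp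
  finally show ?case using Suc by simp
qed (use A B in auto)

text \<open>Identities between sums of matrices are kept entrywise, since the zero of
  \<open>'a mat\<close> depends on the dimensions. This lemma multiplies such an identity by
  \<open>N\<close> on the right.\<close>

lemma sum_mat_index_mult_right:
  assumes F: "\<And>k. k < n \<Longrightarrow> F k \<in> carrier_mat d d" and M: "M \<in> carrier_mat d d"
    and N: "N \<in> carrier_mat d d"
    and eq: "\<And>i j. i < d \<Longrightarrow> j < d \<Longrightarrow> (\<Sum>k<n. F k $$ (i,j)) = M $$ (i,j)"
    and ij: "i < d" "j < d"
  shows "(\<Sum>k<n. (F k * N) $$ (i,j)) = (M * N) $$ (i,j)"
proof -
  have "(\<Sum>k<n. (F k * N) $$ (i,j)) = (\<Sum>k<n. \<Sum>l<d. F k $$ (i,l) * N $$ (l,j))"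
    using F N ij by (intro sum.cong refl mat_index_mult_sum) auto
  also have "\<dots> = (\<Sum>l<d. (\<Sum>k<n. F k $$ (i,l)) * N $$ (l,j))"
    by (subst sum.swap) (simp add: sum_distrib_right)
  also have "\<dots> = (\<Sum>l<d. M $$ (i,l) * N $$ (l,j))" using eq ij by simp
  finally show ?thesis using mat_index_mult_sum[OF M N ij] by simp
qed

lemma sum_mat_index_mult_left:
  assumes F: "\<And>k. k < n \<Longrightarrow> F k \<in> carrier_mat d d" and M: "M \<in> carrier_mat d d"
    and N: "N \<in> carrier_mat d d"
    and eq: "\<And>i j. i < d \<Longrightarrow> j < d \<Longrightarrow> (\<Sum>k<n. F k $$ (i,j)) = M $$ (i,j)"
    and ij: "i < d" "j < d"
  shows "(\<Sum>k<n. (N * F k) $$ (i,j)) = (N * M) $$ (i,j)"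
proof -
  have "(\<Sum>k<n. (N * F k) $$ (i,j)) = (\<Sum>k<n. \<Sum>l<d. N $$ (i,l) * F k $$ (l,j))"
    using F N ij by (intro sum.cong refl mat_index_mult_sum) auto
  also have "\<dots> = (\<Sum>l<d. N $$ (i,l) * (\<Sum>k<n. F k $$ (l,j)))"
    by (subst sum.swap) (simp add: sum_distrib_left)
  also have "\<dots> = (\<Sum>l<d. N $$ (i,l) * M $$ (l,j))" using eq ij by simp
  finally show ?thesis using mat_index_mult_sum[OF N M ij] by simp
qed

lemma sum_nat_blocks:
  "(\<Sum>l<n * d. f l) = (\<Sum>k<n. \<Sum>r<d. f (k * d + r))" for f :: "nat \<Rightarrow> 'b::comm_monoid_add"
proof -
  have "(\<Sum>l<n * d. f l) = (\<Sum>k<n. sum f {k * d..<k * d + d})" by (rule sum.nat_group[symmetric])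
  moreover have "sum f {k * d..<k * d + d} = (\<Sum>r<d. f (k * d + r))" for k
    by (rule sum.reindex_bij_witness[of _ "\<lambda>r. k * d + r" "\<lambda>l. l - k * d"]) auto
  ultimately show ?thesis by simp
qed

lemma block_index_less: "k < n \<Longrightarrow> r < d \<Longrightarrow> k * d + r < n * (d :: nat)"
  by (metis add.commute less_le_trans nat_add_left_cancel_less mult_Suc mult_le_mono1 Suc_leI)

text \<open>\<open>W m k\<close> stands for: the \<open>m\<close>-th term of some sequence has valuation at least \<open>k\<close>.\<close>

lemma recursion_tends_to_zero:
  fixes W :: "nat \<Rightarrow> int \<Rightarrow> bool"
  assumes mono: "\<And>m k l. W m k \<Longrightarrow> l \<le> k \<Longrightarrow> W m l"
    and bounded: "\<And>m. \<exists>k. W m k"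
    and step: "\<And>m k. (\<And>j. j < n \<Longrightarrow> W (m + j) k) \<Longrightarrow> W (m + n) (k + 1)"
  shows "\<forall>\<^sub>F m in sequentially. W m k"
proof -
  obtain b where b: "\<And>m. W m (b m)" using bounded by metis
  \<comment> \<open>A common bound for the first \<open>n\<close> terms; \<open>0\<close> is
    inserted so that the minimum is also defined for \<open>n = 0\<close>.\<close>
  define k0 where "k0 = Min (insert 0 (b ` {..<n}))"
  have base: "W m k0" for m
  proof (induction m rule: less_induct)
    case (less m)
    show ?case
    proof (cases "m < n")
      case True
      then have "k0 \<le> b m" by (auto simp: k0_def intro!: Min_le)
      then show ?thesis using b mono by blast
    next
      case False
      then have "W (m - n + n) (k0 + 1)" by (intro step less) auto
      then show ?thesis using False mono[of m "k0 + 1" k0] by simp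
    qed
  qed
  \<comment> \<open>Every further block of \<open>n\<close> indices gains one unit of
    valuation.\<close>
  have "\<forall>m\<ge>t * n. W m (k0 + int t)" for t
  proof (induction t)
    case (Suc t)
    show ?case
    proof (intro allI impI)
      fix m assume m: "Suc t * n \<le> m"
      have "W (m - n + n) (k0 + int t + 1)" by (rule step) (use Suc m in auto)
      then show "W m (k0 + int (Suc t))" using m by (simp add: algebra_simps)
    qed
  qed (use base in auto)
  moreover have "k \<le> k0 + int (nat (k - k0))" by linarith
  ultimately have "\<forall>m\<ge>nat (k - k0) * n. W m k"
    using mono by blast
  then show ?thesis by (auto simp: eventually_sequentially)
qed

context valued_skew_field
begin

abbreviation mat_ge :: "'a mat \<Rightarrow> int \<Rightarrow> bool" where
  "mat_ge A k \<equiv> mat_over {x. val_ge v x k} A"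

lemma mat_ge_iff: "A \<in> carrier_mat n m \<Longrightarrow> mat_ge A k \<longleftrightarrow> (\<forall>i<n. \<forall>j<m. val_ge v (A $$ (i,j)) k)"
  by (auto simp: mat_over_def)

lemma mat_ge_mono: "mat_ge A k \<Longrightarrow> l \<le> k \<Longrightarrow> mat_ge A l"
  by (auto simp: mat_over_def intro: val_ge_mono)

lemma mat_ge_mult:
  assumes A: "A \<in> carrier_mat n m" and B: "B \<in> carrier_mat m l" and "mat_ge A a" "mat_ge B b"
  shows "mat_ge (A * B) (a + b)"
  using assms(3,4)
  by (auto simp: mat_ge_iff[OF A] mat_ge_iff[OF B] mat_ge_iff[OF mult_carrier_mat[OF A B]]
      mat_index_mult_sum[OF A B] simp del: index_mult_mat intro!: val_ge_sum val_ge_mult)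

lemma mat_ge_bounded: "\<exists>s::nat. mat_ge A (- int s)"
proof -
  define S where "S = (\<lambda>(i,j). nat (- v (A $$ (i,j)))) ` ({..<dim_row A} \<times> {..<dim_col A})"
  have "mat_ge A (- int (Max (insert 0 S)))"
    unfolding mat_over_def
  proof (intro allI impI, rule CollectI)
    fix i j assume "i < dim_row A" "j < dim_col A"
    then have "nat (- v (A $$ (i,j))) \<le> Max (insert 0 S)"
      by (intro Max_ge) (auto simp: S_def)
    then show "val_ge v (A $$ (i,j)) (- int (Max (insert 0 S)))"
      unfolding val_ge_def by linarith
  qed
  then show ?thesis by blast
qed

lemma mat_over_smult:
  assumes "mat_ge A (- int s)"
  shows "mat_over (val_ring v) (\<sigma> ^ s \<cdot>\<^sub>m A)"
  using assms val_ge_mult[of "\<sigma> ^ s" "int s" _ "- int s"]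
  by (auto simp: mat_over_def val_ring_def val_ge_def[of v "\<sigma> ^ s"])

lemma smult_one_mult: "A \<in> carrier_mat n m \<Longrightarrow> (a \<cdot>\<^sub>m 1\<^sub>m n) * A = a \<cdot>\<^sub>m (A :: 'a mat)"
proof (rule eq_matI, goal_cases)
  case (1 i j)
  assume A: "A \<in> carrier_mat n m"
  with 1 have ij: "i < n" "j < m" by auto
  have "((a \<cdot>\<^sub>m 1\<^sub>m n) * A) $$ (i,j) = (\<Sum>l<n. if l = i then a * A $$ (i,j) else 0)"
    using ij by (subst mat_index_mult_sum[OF _ A, of _ n])
      (auto intro!: sum.cong simp del: sum.delta sum.delta')
  then show ?case using A ij by simp
qed auto

lemma unit_over_smult_one:
  assumes "a \<noteq> 0" shows "unit_over UNIV n ((a :: 'a) \<cdot>\<^sub>m 1\<^sub>m n)"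
proof -
  have "(x \<cdot>\<^sub>m 1\<^sub>m n) * (y \<cdot>\<^sub>m 1\<^sub>m n) = 1\<^sub>m n" if "x * y = 1" for x y :: 'a
    using that by (subst smult_one_mult[of _ n n]) (auto intro!: eq_matI)
  with assms show ?thesis unfolding unit_over_def
    by (auto intro!: bexI[of _ "inverse a \<cdot>\<^sub>m 1\<^sub>m n"] simp: mat_over_def)
qed

text \<open>For a square integral matrix, full rank modulo a power of \<open>\<sigma>\<close> can be
  read as left and as right invertibility, so the diagonal form links the two sides. Scaling by a
  power of \<open>\<sigma>\<close> makes \<open>A\<close> integral first.\<close>

lemma right_inverse_imp_left_inverse:
  assumes A: "(A :: 'a mat) \<in> carrier_mat d d" and C: "C \<in> carrier_mat d d" and AC: "A * C = 1\<^sub>m d"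
  shows "C * A = 1\<^sub>m d"
proof -
  obtain s where s: "mat_ge A (- int s)" using mat_ge_bounded by blast
  define S where "S = \<sigma> ^ s \<cdot>\<^sub>m (1\<^sub>m d :: 'a mat)"
  have SA: "S * A \<in> carrier_mat d d" using A by (auto simp: S_def)
  have S: "unit_over UNIV d S" unfolding S_def by (intro unit_over_smult_one) auto
  note unit = unit_over_left_iff[OF bimodule_over_UNIV S A]
  have int: "mat_over (val_ring v) (S * A)"
    using mat_over_smult[OF s] smult_one_mult[OF A] by (simp add: S_def)
  have "right_inv_over UNIV (S * A)"
    unfolding unit using A C AC by (auto simp: right_inv_over_def mat_over_def)
  then obtain C' where C': "C' \<in> carrier_mat d d" "S * A * C' = 1\<^sub>m d"
    using carrier_matD[OF SA] unfolding right_inv_over_def by metis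
  obtain t where t: "mat_ge C' (- int t)" using mat_ge_bounded by blast
  \<comment> \<open>The entries of \<open>C'\<close> have valuation at least
    \<open>- t = 1 - (t + 1)\<close>, hence the exponent \<open>Suc t\<close>.\<close>
  have "right_inv_over {x. val_ge v x (1 - int (Suc t))} (S * A)"
    unfolding right_inv_over_def carrier_matD[OF SA] by (intro bexI[of _ C']) (use C' t in auto)
  then have "left_inv_over {x. val_ge v x (1 - int (Suc t))} (S * A)"
    using rank_mod_iff_right_inv[OF int, of "Suc t"] rank_mod_iff_left_inv[OF int, of "Suc t"]
    unfolding carrier_matD[OF SA] by blast
  then have "left_inv_over UNIV (S * A)"
    by (auto simp: left_inv_over_def mat_over_def)
  then obtain X where X: "X \<in> carrier_mat d d" "X * A = 1\<^sub>m d"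
    unfolding unit using A by (auto simp: left_inv_over_def)
  have "X = X * (A * C)" using X AC by simp
  also have "\<dots> = C" using assoc_mult_mat[OF X(1) A C] X C by simp
  finally show ?thesis using X by simp
qed

text \<open>The inverse is topologically nilpotent. Over a commutative field this means that all
  eigenvalues of \<open>D\<close> in an algebraic closure have negative valuation.\<close>

definition expanding :: "'a mat \<Rightarrow> bool" where
  "expanding D \<longleftrightarrow> (\<exists>E\<in>carrier_mat (dim_row D) (dim_row D). D * E = 1\<^sub>m (dim_row D) \<and>
     E * D = 1\<^sub>m (dim_row D) \<and> (\<forall>k. \<forall>\<^sub>F m in sequentially. mat_ge (E ^\<^sub>m m) k))"

text \<open>Taking one factor \<open>D\<close> out of the relation on the right yields a left
  inverse \<open>E\<close>, which is then two-sided. Multiplying the relation by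
  \<open>E ^\<^sub>m (m + n)\<close> on the right expresses this power as the sum of
  \<open>C l * E ^\<^sub>m (m + n - Suc l)\<close>: the \<open>n\<close> preceding powers with
  coefficients of valuation at least 1.\<close>

lemma expandingI_left:
  assumes D: "D \<in> carrier_mat d d" and C: "\<And>k. k < n \<Longrightarrow> C k \<in> carrier_mat d d \<and> mat_ge (C k) 1"
    and eq: "\<And>i j. i < d \<Longrightarrow> j < d \<Longrightarrow> (\<Sum>k<n. (C k * D ^\<^sub>m Suc k) $$ (i,j)) = 1\<^sub>m d $$ (i,j)"
  shows "expanding D"
proof -
  define E where "E = mat d d (\<lambda>(i,j). \<Sum>k<n. (C k * D ^\<^sub>m k) $$ (i,j))"
  have E: "E \<in> carrier_mat d d" by (simp add: E_def)
  have ED: "E * D = 1\<^sub>m d"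
  proof (rule eq_matI, goal_cases)
    case (1 i j)
    then have ij: "i < d" "j < d" by auto
    have "(E * D) $$ (i,j) = (\<Sum>k<n. ((C k * D ^\<^sub>m k) * D) $$ (i,j))"
      by (intro sum_mat_index_mult_right[symmetric, of _ _ d]) (use C D ij in \<open>auto simp: E_def intro!: mult_carrier_mat[of _ d d]\<close>)
    also have "\<dots> = (\<Sum>k<n. (C k * D ^\<^sub>m Suc k) $$ (i,j))"
      using C D by (intro sum.cong) (auto simp: assoc_mult_mat[of _ d d _ d _ d] simp del: index_mult_mat)
    finally show ?case using eq ij by simp
  qed (use E D in auto)
  have DE: "D * E = 1\<^sub>m d" using right_inverse_imp_left_inverse[OF E D ED] .
  have "\<forall>\<^sub>F m in sequentially. mat_ge (E ^\<^sub>m m) k" for k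
  proof (rule recursion_tends_to_zero[of "\<lambda>m. mat_ge (E ^\<^sub>m m)" n])
    fix m k assume W: "mat_ge (E ^\<^sub>m (m + j)) k" if "j < n" for j
    have "val_ge v ((E ^\<^sub>m (m + n)) $$ (i,j)) (k + 1)" if ij: "i < d" "j < d" for i j
    proof -
      have "(E ^\<^sub>m (m + n)) $$ (i,j) = (1\<^sub>m d * E ^\<^sub>m (m + n)) $$ (i,j)" using E by simp
      also have "\<dots> = (\<Sum>l<n. ((C l * D ^\<^sub>m Suc l) * E ^\<^sub>m (m + n)) $$ (i,j))"
        by (intro sum_mat_index_mult_right[symmetric, of _ _ d]) (use C D E ij eq in \<open>auto intro!: mult_carrier_mat[of _ d d]\<close>)
      finally have *: "(E ^\<^sub>m (m + n)) $$ (i,j)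
          = (\<Sum>l<n. ((C l * D ^\<^sub>m Suc l) * E ^\<^sub>m (m + n)) $$ (i,j))" .
      have "val_ge v (((C l * D ^\<^sub>m Suc l) * E ^\<^sub>m (m + n)) $$ (i,j)) (1 + k)" if l: "l < n" for l
      proof -
        \<comment> \<open>After \<open>D ^\<^sub>m Suc l\<close> has cancelled, the exponent
          \<open>m + q\<close> remains, and \<open>q < n\<close> keeps it among the powers covered
          by \<open>W\<close>.\<close>
        define q where "q = n - Suc l"
        have q: "m + n = Suc l + (m + q)" "q < n" using l by (auto simp: q_def)
        have "D ^\<^sub>m Suc l * E ^\<^sub>m (m + n) = D ^\<^sub>m Suc l * (E ^\<^sub>m Suc l * E ^\<^sub>m (m + q))"
          unfolding q pow_mat_add[OF E, of "Suc l"] ..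
        also have "\<dots> = 1\<^sub>m d * E ^\<^sub>m (m + q)"
          unfolding pow_mat_mult_inverse[OF D E DE, of "Suc l", symmetric]
          by (rule assoc_mult_mat[symmetric, of _ d d _ d _ d]) (use D E in auto)
        finally have "D ^\<^sub>m Suc l * E ^\<^sub>m (m + n) = E ^\<^sub>m (m + q)" using E by simp
        then have "(C l * D ^\<^sub>m Suc l) * E ^\<^sub>m (m + n) = C l * E ^\<^sub>m (m + q)"
          using C[OF l] D E by (simp add: assoc_mult_mat[of _ d d _ d _ d] del: pow_mat.simps)
        moreover have "mat_ge (C l * E ^\<^sub>m (m + q)) (1 + k)"
          using C[OF l] E W q(2) by (intro mat_ge_mult[of _ d d _ d]) auto
        ultimately show ?thesis using ij C[OF l] E by (auto simp: mat_over_def)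
      qed
      then show ?thesis unfolding * by (intro val_ge_sum) (auto simp: add.commute)
    qed
    then show "mat_ge (E ^\<^sub>m (m + n)) (k + 1)" using E by (subst mat_ge_iff[of _ d d]) auto
  qed (use mat_ge_mono mat_ge_bounded in blast)+
  then show ?thesis using D E DE ED by (auto simp: expanding_def)
qed

text \<open>Mirror image of \<open>expandingI_left\<close>: the factor \<open>D\<close> is taken out
  on the left, and the relation is multiplied by powers of \<open>E\<close> from the left.\<close>

lemma expandingI_right:
  assumes D: "D \<in> carrier_mat d d" and C: "\<And>k. k < n \<Longrightarrow> C k \<in> carrier_mat d d \<and> mat_ge (C k) 1"
    and eq: "\<And>i j. i < d \<Longrightarrow> j < d \<Longrightarrow> (\<Sum>k<n. (D ^\<^sub>m Suc k * C k) $$ (i,j)) = 1\<^sub>m d $$ (i,j)"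
  shows "expanding D"
proof -
  have Dpow: "D ^\<^sub>m Suc k = D * D ^\<^sub>m k" for k using pow_mat_add[OF D, of 1 k] D by simp
  define E where "E = mat d d (\<lambda>(i,j). \<Sum>k<n. (D ^\<^sub>m k * C k) $$ (i,j))"
  have E: "E \<in> carrier_mat d d" by (simp add: E_def)
  have DE: "D * E = 1\<^sub>m d"
  proof (rule eq_matI, goal_cases)
    case (1 i j)
    then have ij: "i < d" "j < d" by auto
    have "(D * E) $$ (i,j) = (\<Sum>k<n. (D * (D ^\<^sub>m k * C k)) $$ (i,j))"
      by (intro sum_mat_index_mult_left[symmetric, of _ _ d]) (use C D ij in \<open>auto simp: E_def intro!: mult_carrier_mat[of _ d d]\<close>)
    also have "\<dots> = (\<Sum>k<n. (D ^\<^sub>m Suc k * C k) $$ (i,j))"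
      unfolding Dpow
      using C D by (intro sum.cong) (auto simp: assoc_mult_mat[of _ d d _ d _ d] simp del: index_mult_mat)
    finally show ?case using eq ij by simp
  qed (use E D in auto)
  have ED: "E * D = 1\<^sub>m d" using right_inverse_imp_left_inverse[OF D E DE] .
  have "\<forall>\<^sub>F m in sequentially. mat_ge (E ^\<^sub>m m) k" for k
  proof (rule recursion_tends_to_zero[of "\<lambda>m. mat_ge (E ^\<^sub>m m)" n])
    fix m k assume W: "mat_ge (E ^\<^sub>m (m + j)) k" if "j < n" for j
    have "val_ge v ((E ^\<^sub>m (m + n)) $$ (i,j)) (k + 1)" if ij: "i < d" "j < d" for i j
    proof -
      have "(E ^\<^sub>m (m + n)) $$ (i,j) = (E ^\<^sub>m (m + n) * 1\<^sub>m d) $$ (i,j)" using E by simp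
      also have "\<dots> = (\<Sum>l<n. (E ^\<^sub>m (m + n) * (D ^\<^sub>m Suc l * C l)) $$ (i,j))"
        by (intro sum_mat_index_mult_left[symmetric, of _ _ d]) (use C D E ij eq in \<open>auto intro!: mult_carrier_mat[of _ d d]\<close>)
      finally have *: "(E ^\<^sub>m (m + n)) $$ (i,j)
          = (\<Sum>l<n. (E ^\<^sub>m (m + n) * (D ^\<^sub>m Suc l * C l)) $$ (i,j))" .
      have "val_ge v ((E ^\<^sub>m (m + n) * (D ^\<^sub>m Suc l * C l)) $$ (i,j)) (k + 1)" if l: "l < n" for l
      proof -
        define q where "q = n - Suc l"
        have q: "m + n = (m + q) + Suc l" "q < n" using l by (auto simp: q_def)
        have "E ^\<^sub>m (m + n) * D ^\<^sub>m Suc l = E ^\<^sub>m (m + q) * E ^\<^sub>m Suc l * D ^\<^sub>m Suc l"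
          unfolding q pow_mat_add[OF E, of "m + q"] ..
        also have "\<dots> = E ^\<^sub>m (m + q) * 1\<^sub>m d"
          unfolding pow_mat_mult_inverse[OF E D ED, of "Suc l", symmetric]
          by (rule assoc_mult_mat[of _ d d _ d _ d]) (use D E in auto)
        finally have "E ^\<^sub>m (m + n) * D ^\<^sub>m Suc l = E ^\<^sub>m (m + q)" using E by simp
        then have "E ^\<^sub>m (m + n) * (D ^\<^sub>m Suc l * C l) = E ^\<^sub>m (m + q) * C l"
          using C[OF l] D E assoc_mult_mat[of "E ^\<^sub>m (m + n)" d d "D ^\<^sub>m Suc l" d "C l" d]
          by (simp del: pow_mat.simps)
        moreover have "mat_ge (E ^\<^sub>m (m + q) * C l) (k + 1)"
          using C[OF l] E W q(2) by (intro mat_ge_mult[of _ d d _ d]) auto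
        ultimately show ?thesis using ij C[OF l] E by (auto simp: mat_over_def)
      qed
      then show ?thesis unfolding * by (intro val_ge_sum) auto
    qed
    then show "mat_ge (E ^\<^sub>m (m + n)) (k + 1)" using E by (subst mat_ge_iff[of _ d d]) auto
  qed (use mat_ge_mono mat_ge_bounded in blast)+
  then show ?thesis using D E DE ED by (auto simp: expanding_def)
qed

lemma expandingE:
  assumes D: "D \<in> carrier_mat d d" and "expanding D"
  obtains E n where "E \<in> carrier_mat d d" "n \<ge> 1" "mat_ge (E ^\<^sub>m n) 1"
    "E ^\<^sub>m n * D ^\<^sub>m n = 1\<^sub>m d" "D ^\<^sub>m n * E ^\<^sub>m n = 1\<^sub>m d"
proof -
  obtain E where E: "E \<in> carrier_mat d d" "D * E = 1\<^sub>m d" "E * D = 1\<^sub>m d"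
    "\<forall>\<^sub>F m in sequentially. mat_ge (E ^\<^sub>m m) 1"
    using assms by (auto simp: expanding_def)
  from E(4) eventually_ge_at_top[of 1] have "\<forall>\<^sub>F m in sequentially. mat_ge (E ^\<^sub>m m) 1 \<and> 1 \<le> m"
    by (rule eventually_conj)
  then obtain n where "mat_ge (E ^\<^sub>m n) 1" "1 \<le> n" by (auto simp: eventually_sequentially)
  then show ?thesis
    using that E pow_mat_mult_inverse[OF D E(1,2), of n] pow_mat_mult_inverse[OF E(1) D E(3), of n]
    by auto
qed

section \<open>The three rank conditions as relations between powers of \<open>D\<close>\<close>

lemma s_seq_bound:
  assumes D: "D \<in> carrier_mat d d" and k: "1 \<le> k" "k \<le> n"
  shows "mat_ge (D ^\<^sub>m k) (- int (s_seq v D n))"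
proof -
  have "\<forall>k. \<exists>s::nat. mat_ge (D ^\<^sub>m k) (- int s)" using mat_ge_bounded by blast
  from choice[OF this] obtain s where s: "\<And>k. mat_ge (D ^\<^sub>m k) (- int (s k))" by blast
  \<comment> \<open>The \<open>LEAST\<close> in \<open>s_seq\<close> is meaningful once some common
    bound exists; the maximum of the bounds for the single powers is one.\<close>
  have "\<exists>s::nat. \<forall>k\<in>{1..n}. \<forall>i<dim_row D. \<forall>j<dim_col D. val_ge v ((D ^\<^sub>m k) $$ (i,j)) (- int s)"
  proof (intro exI ballI allI impI)
    fix k i j assume *: "k \<in> {1..n}" "i < dim_row D" "j < dim_col D"
    have "val_ge v ((D ^\<^sub>m k) $$ (i,j)) (- int (s k))"
      using s[of k] D * by (auto simp: mat_over_def)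
    moreover have "s k \<le> Max (s ` {1..n})" using * by (intro Max_ge) auto
    ultimately show "val_ge v ((D ^\<^sub>m k) $$ (i,j)) (- int (Max (s ` {1..n})))"
      by (elim val_ge_mono) auto
  qed
  from LeastI_ex[OF this] show ?thesis
    using D k by (auto simp: s_seq_def mat_over_def)
qed

text \<open>The scalar matrix \<open>S\<close> standing between \<open>C\<close> and
  \<open>D ^\<^sub>m n\<close> is absorbed by the left inverse, as \<open>X = C * S\<close>. This
  shifts the valuation bound from \<open>1 - s\<close> to \<open>1\<close> without commuting
  \<open>\<sigma>\<close> past \<open>D\<close>.\<close>

lemma rank_power_iff:
  assumes D: "D \<in> carrier_mat d d" and s: "mat_ge (D ^\<^sub>m n) (- int s)"
  shows "rank_mod v \<sigma> s (\<sigma> ^ s \<cdot>\<^sub>m (D ^\<^sub>m n)) d \<longleftrightarrow>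
    (\<exists>X\<in>carrier_mat d d. mat_ge X 1 \<and> X * D ^\<^sub>m n = 1\<^sub>m d)"
proof -
  define S T where "S = \<sigma> ^ s \<cdot>\<^sub>m (1\<^sub>m d :: 'a mat)" and "T = inverse (\<sigma> ^ s) \<cdot>\<^sub>m (1\<^sub>m d :: 'a mat)"
  have [simp]: "S \<in> carrier_mat d d" "T \<in> carrier_mat d d" "D ^\<^sub>m n \<in> carrier_mat d d"
    using D by (auto simp: S_def T_def)
  have TS: "T * S = 1\<^sub>m d" unfolding T_def
    by (subst smult_one_mult[of _ d d]) (auto simp: S_def intro!: eq_matI)
  have Sge: "mat_ge S (int s)" "mat_ge T (- int s)"
    by (auto simp: S_def T_def mat_over_def val_ge_def v_inverse)
  have SD: "\<sigma> ^ s \<cdot>\<^sub>m (D ^\<^sub>m n) = S * D ^\<^sub>m n"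
    unfolding S_def by (rule smult_one_mult[symmetric, of _ d d]) simp
  have "rank_mod v \<sigma> s (\<sigma> ^ s \<cdot>\<^sub>m (D ^\<^sub>m n)) d
      \<longleftrightarrow> left_inv_over {x. val_ge v x (1 - int s)} (\<sigma> ^ s \<cdot>\<^sub>m (D ^\<^sub>m n))"
    using rank_mod_iff_left_inv[OF mat_over_smult[OF s], of s] carrier_matD(2)[OF pow_carrier_mat[OF D, of n]]
    by (simp only: index_smult_mat)
  also have "\<dots> \<longleftrightarrow> (\<exists>C\<in>carrier_mat d d. mat_ge C (1 - int s) \<and> C * (S * D ^\<^sub>m n) = 1\<^sub>m d)"
    unfolding SD left_inv_over_def using D by (simp add: S_def)
  also have "\<dots> \<longleftrightarrow> (\<exists>X\<in>carrier_mat d d. mat_ge X 1 \<and> X * D ^\<^sub>m n = 1\<^sub>m d)"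
  proof (intro iffI; elim bexE conjE)
    fix C assume C: "C \<in> carrier_mat d d" "mat_ge C (1 - int s)" "C * (S * D ^\<^sub>m n) = 1\<^sub>m d"
    then show "\<exists>X\<in>carrier_mat d d. mat_ge X 1 \<and> X * D ^\<^sub>m n = 1\<^sub>m d"
      using mat_ge_mult[OF C(1) _ C(2) Sge(1), of d]
      by (intro bexI[of _ "C * S"]) (auto simp: assoc_mult_mat[of _ d d _ d _ d])
  next
    fix X assume X: "X \<in> carrier_mat d d" "mat_ge X 1" "X * D ^\<^sub>m n = 1\<^sub>m d"
    have "T * (S * D ^\<^sub>m n) = D ^\<^sub>m n"
      using assoc_mult_mat[of T d d S d "D ^\<^sub>m n" d] TS D by simp
    then have "X * T * (S * D ^\<^sub>m n) = 1\<^sub>m d"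
      using X(1,3) assoc_mult_mat[of X d d T d "S * D ^\<^sub>m n" d] by (simp add: mult_carrier_mat[of _ d d])
    then show "\<exists>C\<in>carrier_mat d d. mat_ge C (1 - int s) \<and> C * (S * D ^\<^sub>m n) = 1\<^sub>m d"
      using mat_ge_mult[OF X(1) _ X(2) Sge(2), of d] X(1)
      by (intro bexI[of _ "X * T"]) auto
  qed
  finally show ?thesis .
qed

lemma rank_power_iff_expanding:
  assumes D: "D \<in> carrier_mat d d"
  shows "(\<exists>n\<ge>1. rank_mod v \<sigma> (s_seq v D n) (\<sigma> ^ s_seq v D n \<cdot>\<^sub>m (D ^\<^sub>m n)) d) \<longleftrightarrow> expanding D"
proof
  assume "\<exists>n\<ge>1. rank_mod v \<sigma> (s_seq v D n) (\<sigma> ^ s_seq v D n \<cdot>\<^sub>m (D ^\<^sub>m n)) d"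
  then obtain n where n: "n \<ge> 1" "rank_mod v \<sigma> (s_seq v D n) (\<sigma> ^ s_seq v D n \<cdot>\<^sub>m (D ^\<^sub>m n)) d"
    by blast
  then obtain X where X: "X \<in> carrier_mat d d" "mat_ge X 1" "X * D ^\<^sub>m n = 1\<^sub>m d"
    using rank_power_iff[OF D s_seq_bound[OF D]] by auto
  obtain m where m: "n = Suc m" using n(1) by (cases n) auto
  \<comment> \<open>A relation with one nonzero term; index \<open>m\<close> belongs to the power
    \<open>Suc m = n\<close>.\<close>
  define C where "C = (\<lambda>k. if k = m then X else 0\<^sub>m d d)"
  show "expanding D"
  proof (rule expandingI_left[OF D, of "Suc m" C])
    fix i j assume ij: "i < d" "j < d"
    have zero: "0\<^sub>m d d * D ^\<^sub>m Suc k = 0\<^sub>m d d" for k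
      using D by (intro left_mult_zero_mat) auto
    have "(\<Sum>k<Suc m. (C k * D ^\<^sub>m Suc k) $$ (i,j)) = (\<Sum>k<Suc m. if k = m then 1\<^sub>m d $$ (i,j) else 0)"
      using X(3) ij by (intro sum.cong) (auto simp: C_def m zero simp del: index_mult_mat pow_mat.simps)
    then show "(\<Sum>k<Suc m. (C k * D ^\<^sub>m Suc k) $$ (i,j)) = 1\<^sub>m d $$ (i,j)"
      by simp
  qed (use X in \<open>auto simp: C_def mat_over_def\<close>)
next
  assume "expanding D"
  then obtain E n where En: "E \<in> carrier_mat d d" "n \<ge> 1" "mat_ge (E ^\<^sub>m n) 1"
    "E ^\<^sub>m n * D ^\<^sub>m n = 1\<^sub>m d" using expandingE[OF D] by metis
  then show "\<exists>n\<ge>1. rank_mod v \<sigma> (s_seq v D n) (\<sigma> ^ s_seq v D n \<cdot>\<^sub>m (D ^\<^sub>m n)) d"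
    using rank_power_iff[OF D s_seq_bound[OF D]]
    by (intro exI[of _ n] conjI) (auto intro!: bexI[of _ "E ^\<^sub>m n"])
qed

text \<open>The left inverse is cut into \<open>n\<close> square blocks. Each block meets
  \<open>\<sigma> ^ s\<close> directly on its right and absorbs it.\<close>

lemma rank_block_col_iff:
  assumes D: "D \<in> carrier_mat d d" and s: "\<And>k. k < n \<Longrightarrow> mat_ge (D ^\<^sub>m Suc k) (- int s)"
  shows "rank_mod v \<sigma> s (block_col \<sigma> s D n) d \<longleftrightarrow>
    (\<exists>C. (\<forall>k<n. C k \<in> carrier_mat d d \<and> mat_ge (C k) 1) \<and>
      (\<forall>i<d. \<forall>j<d. (\<Sum>k<n. (C k * D ^\<^sub>m Suc k) $$ (i,j)) = 1\<^sub>m d $$ (i,j)))"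
    (is "?L \<longleftrightarrow> ?R")
proof -
  define B where "B = block_col \<sigma> s D n"
  have B: "B \<in> carrier_mat (n * d) d" using D by (auto simp: B_def block_col_def Let_def)
  have Bnth: "B $$ (k * d + r, j) = \<sigma> ^ s * (D ^\<^sub>m Suc k) $$ (r,j)" if "k < n" "r < d" "j < d" for k r j
  proof -
    have "k * d + r < n * d" using that
      by (intro block_index_less)
    then show ?thesis using that D by (auto simp: B_def block_col_def Let_def)
  qed
  have "mat_over (val_ring v) B"
    unfolding mat_over_def
  proof (intro allI impI)
    fix i j assume ij: "i < dim_row B" "j < dim_col B"
    have "d > 0" "i div d < n" "i mod d < d" using ij B
      by (auto simp: less_mult_imp_div_less intro!: mod_less_divisor intro: gr0I)
    then show "B $$ (i,j) \<in> val_ring v"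
      using Bnth[of "i div d" "i mod d" j] ij B s[of "i div d"] D
        val_ge_mult[of "\<sigma> ^ s" "int s" _ "- int s"]
      by (auto simp: mat_over_def val_ring_def val_ge_def[of v "\<sigma> ^ s"] simp del: pow_mat.simps)
  qed
  from rank_mod_iff_left_inv[OF this, of s]
  have "?L \<longleftrightarrow> left_inv_over {x. val_ge v x (1 - int s)} B" using B by (simp add: B_def)
  also have "\<dots> \<longleftrightarrow> ?R"
  proof
    assume "left_inv_over {x. val_ge v x (1 - int s)} B"
    then obtain C where C: "C \<in> carrier_mat d (n * d)" "mat_ge C (1 - int s)" "C * B = 1\<^sub>m d"
      using B by (auto simp: left_inv_over_def)
    define F where "F = (\<lambda>k. mat d d (\<lambda>(i,r). C $$ (i, k * d + r) * \<sigma> ^ s))"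
    have "mat_ge (F k) 1" if "k < n" for k
      unfolding mat_over_def
    proof (intro allI impI, rule CollectI)
      fix i j assume ij: "i < dim_row (F k)" "j < dim_col (F k)"
      have "k * d + j < n * d" using that ij
        by (auto simp: F_def intro: block_index_less)
      then have "val_ge v (C $$ (i, k * d + j)) (1 - int s)"
        using C(1,2) ij by (auto simp: mat_over_def F_def)
      then show "val_ge v (F k $$ (i,j)) 1"
        using val_ge_mult[of "C $$ (i, k * d + j)" "1 - int s" "\<sigma> ^ s" "int s"] ij
        by (auto simp: F_def val_ge_def[of v "\<sigma> ^ s"])
    qed
    moreover have "(\<Sum>k<n. (F k * D ^\<^sub>m Suc k) $$ (i,j)) = 1\<^sub>m d $$ (i,j)" if ij: "i < d" "j < d" for i j
    proof -
      have "1\<^sub>m d $$ (i,j) = (\<Sum>l<n * d. C $$ (i,l) * B $$ (l,j))"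
        using mat_index_mult_sum[OF C(1) B ij] C(3) by simp
      also have "\<dots> = (\<Sum>k<n. \<Sum>r<d. F k $$ (i,r) * (D ^\<^sub>m Suc k) $$ (r,j))"
        unfolding sum_nat_blocks using ij
        by (intro sum.cong refl) (auto simp: Bnth F_def mult.assoc simp del: pow_mat.simps)
      also have "\<dots> = (\<Sum>k<n. (F k * D ^\<^sub>m Suc k) $$ (i,j))"
        using ij D
        by (intro sum.cong refl mat_index_mult_sum[symmetric]) (auto simp: F_def)
      finally show ?thesis ..
    qed
    ultimately show ?R by (intro exI[of _ F]) (auto simp: F_def)
  next
    assume ?R
    then obtain F where F: "\<And>k. k < n \<Longrightarrow> F k \<in> carrier_mat d d \<and> mat_ge (F k) 1"
      "\<And>i j. i < d \<Longrightarrow> j < d \<Longrightarrow> (\<Sum>k<n. (F k * D ^\<^sub>m Suc k) $$ (i,j)) = 1\<^sub>m d $$ (i,j)" by blast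
    define C where "C = mat d (n * d) (\<lambda>(i,l). F (l div d) $$ (i, l mod d) * inverse (\<sigma> ^ s))"
    have C: "C \<in> carrier_mat d (n * d)" by (simp add: C_def)
    have "mat_ge C (1 - int s)"
      unfolding mat_over_def
    proof (intro allI impI, rule CollectI)
      fix i j assume ij: "i < dim_row C" "j < dim_col C"
      then have *: "d > 0" "j div d < n" "j mod d < d"
        by (auto simp: C_def less_mult_imp_div_less intro!: mod_less_divisor intro: gr0I)
      then have "val_ge v (F (j div d) $$ (i, j mod d)) 1"
        using F(1)[of "j div d"] ij by (auto simp: mat_over_def C_def)
      then show "val_ge v (C $$ (i,j)) (1 - int s)"
        using val_ge_mult[of "F (j div d) $$ (i, j mod d)" 1 "inverse (\<sigma> ^ s)" "- int s"] ij
        by (auto simp: C_def val_ge_def[of v "inverse (\<sigma> ^ s)"] v_inverse)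
    qed
    moreover have "C * B = 1\<^sub>m d"
    proof (rule eq_matI, goal_cases)
      case (1 i j)
      then have ij: "i < d" "j < d" by auto
      have Cnth: "C $$ (i, k * d + r) = F k $$ (i,r) * inverse (\<sigma> ^ s)" if "k < n" "r < d" for k r
        using that ij block_index_less[of k n r d] by (auto simp: C_def)
      have "(C * B) $$ (i,j) = (\<Sum>l<n * d. C $$ (i,l) * B $$ (l,j))"
        by (rule mat_index_mult_sum[OF C B ij])
      also have "\<dots> = (\<Sum>k<n. \<Sum>r<d. F k $$ (i,r) * (D ^\<^sub>m Suc k) $$ (r,j))"
        unfolding sum_nat_blocks
      proof (intro sum.cong refl)
        fix k r assume kr: "k \<in> {..<n}" "r \<in> {..<d}"
        have "inverse (\<sigma> ^ s) * (\<sigma> ^ s * x) = x" for x by (simp add: mult.assoc[symmetric])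
        then show "C $$ (i, k * d + r) * B $$ (k * d + r, j) = F k $$ (i,r) * (D ^\<^sub>m Suc k) $$ (r,j)"
          using kr ij by (simp add: Bnth Cnth mult.assoc del: pow_mat.simps)
      qed
      also have "\<dots> = (\<Sum>k<n. (F k * D ^\<^sub>m Suc k) $$ (i,j))"
        using ij D F(1)
        by (intro sum.cong refl mat_index_mult_sum[symmetric]) auto
      finally show ?case using F(2) ij by simp
    qed (use C B in auto)
    ultimately show "left_inv_over {x. val_ge v x (1 - int s)} B"
      using C B by (auto simp: left_inv_over_def)
  qed
  finally show ?thesis .
qed

text \<open>Here \<open>\<sigma> ^ s\<close> and the blocks of the right inverse lie on opposite
  sides of the powers of \<open>D\<close>, so direct absorption fails. The relation is conjugated by
  \<open>\<sigma> ^ s\<close> instead, which fixes the entries 0 and 1 of the identity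
  matrix.\<close>

lemma rank_block_row_iff:
  assumes D: "D \<in> carrier_mat d d" and s: "\<And>k. k < n \<Longrightarrow> mat_ge (D ^\<^sub>m Suc k) (- int s)"
  shows "rank_mod v \<sigma> s (block_row \<sigma> s D n) d \<longleftrightarrow>
    (\<exists>C. (\<forall>k<n. C k \<in> carrier_mat d d \<and> mat_ge (C k) 1) \<and>
      (\<forall>i<d. \<forall>j<d. (\<Sum>k<n. (D ^\<^sub>m Suc k * C k) $$ (i,j)) = 1\<^sub>m d $$ (i,j)))"
    (is "?L \<longleftrightarrow> ?R")
proof -
  define B where "B = block_row \<sigma> s D n"
  have B: "B \<in> carrier_mat d (n * d)" using D by (auto simp: B_def block_row_def Let_def)
  have Bnth: "B $$ (i, k * d + r) = \<sigma> ^ s * (D ^\<^sub>m Suc k) $$ (i,r)" if "k < n" "r < d" "i < d" for k r i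
    using that D block_index_less[of k n r d] by (auto simp: B_def block_row_def Let_def)
  have "mat_over (val_ring v) B"
    unfolding mat_over_def
  proof (intro allI impI)
    fix i j assume ij: "i < dim_row B" "j < dim_col B"
    have "d > 0" "j div d < n" "j mod d < d" using ij B
      by (auto simp: less_mult_imp_div_less intro!: mod_less_divisor intro: gr0I)
    then show "B $$ (i,j) \<in> val_ring v"
      using Bnth[of "j div d" "j mod d" i] ij B s[of "j div d"] D
        val_ge_mult[of "\<sigma> ^ s" "int s" _ "- int s"]
      by (auto simp: mat_over_def val_ring_def val_ge_def[of v "\<sigma> ^ s"] simp del: pow_mat.simps)
  qed
  from rank_mod_iff_right_inv[OF this, of s]
  have "?L \<longleftrightarrow> right_inv_over {x. val_ge v x (1 - int s)} B" using B by (simp add: B_def)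
  also have "\<dots> \<longleftrightarrow> ?R"
  proof
    assume "right_inv_over {x. val_ge v x (1 - int s)} B"
    then obtain C where C: "C \<in> carrier_mat (n * d) d" "mat_ge C (1 - int s)" "B * C = 1\<^sub>m d"
      using B by (auto simp: right_inv_over_def)
    define F where "F = (\<lambda>k. mat d d (\<lambda>(r,j). C $$ (k * d + r, j) * \<sigma> ^ s))"
    have "mat_ge (F k) 1" if "k < n" for k
      unfolding mat_over_def
    proof (intro allI impI, rule CollectI)
      fix i j assume ij: "i < dim_row (F k)" "j < dim_col (F k)"
      have "k * d + i < n * d" using that ij
        by (auto simp: F_def intro: block_index_less)
      then have "val_ge v (C $$ (k * d + i, j)) (1 - int s)"
        using C(1,2) ij by (auto simp: mat_over_def F_def)
      then show "val_ge v (F k $$ (i,j)) 1"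
        using val_ge_mult[of "C $$ (k * d + i, j)" "1 - int s" "\<sigma> ^ s" "int s"] ij
        by (auto simp: F_def val_ge_def[of v "\<sigma> ^ s"])
    qed
    moreover have "(\<Sum>k<n. (D ^\<^sub>m Suc k * F k) $$ (i,j)) = 1\<^sub>m d $$ (i,j)" if ij: "i < d" "j < d" for i j
    proof -
      define x where "x = (\<Sum>k<n. \<Sum>r<d. (D ^\<^sub>m Suc k) $$ (i,r) * C $$ (k * d + r, j))"
      have "1\<^sub>m d $$ (i,j) = (\<Sum>l<n * d. B $$ (i,l) * C $$ (l,j))"
        using mat_index_mult_sum[OF B C(1) ij] C(3) by simp
      also have "\<dots> = \<sigma> ^ s * x"
        unfolding sum_nat_blocks x_def sum_distrib_left using ij
        by (intro sum.cong refl) (auto simp: Bnth mult.assoc simp del: pow_mat.simps)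
      finally have x: "\<sigma> ^ s * x = 1\<^sub>m d $$ (i,j)" by simp
      have "(\<Sum>k<n. (D ^\<^sub>m Suc k * F k) $$ (i,j))
          = (\<Sum>k<n. \<Sum>r<d. (D ^\<^sub>m Suc k) $$ (i,r) * F k $$ (r,j))"
        using ij D
        by (intro sum.cong refl mat_index_mult_sum) (auto simp: F_def)
      also have "\<dots> = x * \<sigma> ^ s"
        unfolding x_def sum_distrib_right using ij
        by (intro sum.cong refl) (auto simp: F_def mult.assoc simp del: pow_mat.simps)
      \<comment> \<open>Written as a conjugate of \<open>\<sigma> ^ s * x\<close>, which is known to
        be 0 or 1.\<close>
      also have "\<dots> = inverse (\<sigma> ^ s) * (\<sigma> ^ s * x) * \<sigma> ^ s"
        by (simp add: mult.assoc[symmetric])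
      also have "\<dots> = 1\<^sub>m d $$ (i,j)" unfolding x using ij by simp
      finally show ?thesis .
    qed
    ultimately show ?R by (intro exI[of _ F]) (auto simp: F_def)
  next
    assume ?R
    then obtain F where F: "\<And>k. k < n \<Longrightarrow> F k \<in> carrier_mat d d \<and> mat_ge (F k) 1"
      "\<And>i j. i < d \<Longrightarrow> j < d \<Longrightarrow> (\<Sum>k<n. (D ^\<^sub>m Suc k * F k) $$ (i,j)) = 1\<^sub>m d $$ (i,j)" by blast
    define C where "C = mat (n * d) d (\<lambda>(l,j). F (l div d) $$ (l mod d, j) * inverse (\<sigma> ^ s))"
    have C: "C \<in> carrier_mat (n * d) d" by (simp add: C_def)
    have "mat_ge C (1 - int s)"
      unfolding mat_over_def
    proof (intro allI impI, rule CollectI)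
      fix i j assume ij: "i < dim_row C" "j < dim_col C"
      then have *: "d > 0" "i div d < n" "i mod d < d"
        by (auto simp: C_def less_mult_imp_div_less intro!: mod_less_divisor intro: gr0I)
      then have "val_ge v (F (i div d) $$ (i mod d, j)) 1"
        using F(1)[of "i div d"] ij by (auto simp: mat_over_def C_def)
      then show "val_ge v (C $$ (i,j)) (1 - int s)"
        using val_ge_mult[of "F (i div d) $$ (i mod d, j)" 1 "inverse (\<sigma> ^ s)" "- int s"] ij
        by (auto simp: C_def val_ge_def[of v "inverse (\<sigma> ^ s)"] v_inverse)
    qed
    moreover have "B * C = 1\<^sub>m d"
    proof (rule eq_matI, goal_cases)
      case (1 i j)
      then have ij: "i < d" "j < d" by auto
      have Cnth: "C $$ (k * d + r, j) = F k $$ (r,j) * inverse (\<sigma> ^ s)" if "k < n" "r < d" for k r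
        using that ij block_index_less[of k n r d] by (auto simp: C_def)
      define x where "x = (\<Sum>k<n. \<Sum>r<d. (D ^\<^sub>m Suc k) $$ (i,r) * F k $$ (r,j))"
      have "x = (\<Sum>k<n. (D ^\<^sub>m Suc k * F k) $$ (i,j))"
        unfolding x_def using ij D F(1)
        by (intro sum.cong refl mat_index_mult_sum[symmetric]) auto
      then have x: "x = 1\<^sub>m d $$ (i,j)" using F(2) ij by simp
      have "(B * C) $$ (i,j) = (\<Sum>l<n * d. B $$ (i,l) * C $$ (l,j))"
        by (rule mat_index_mult_sum[OF B C ij])
      also have "\<dots> = \<sigma> ^ s * x * inverse (\<sigma> ^ s)"
        unfolding sum_nat_blocks x_def sum_distrib_left sum_distrib_right using ij
        by (intro sum.cong refl) (auto simp: Bnth Cnth mult.assoc simp del: pow_mat.simps)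
      finally show ?case unfolding x using ij by simp
    qed (use C B in auto)
    ultimately show "right_inv_over {x. val_ge v x (1 - int s)} B"
      using C B by (auto simp: right_inv_over_def)
  qed
  finally show ?thesis .
qed

lemma rank_block_col_iff_expanding:
  assumes D: "D \<in> carrier_mat d d"
  shows "(\<exists>n\<ge>1. rank_mod v \<sigma> (s_seq v D n) (block_col \<sigma> (s_seq v D n) D n) d) \<longleftrightarrow> expanding D"
proof -
  have iff: "rank_mod v \<sigma> (s_seq v D n) (block_col \<sigma> (s_seq v D n) D n) d \<longleftrightarrow>
    (\<exists>C. (\<forall>k<n. C k \<in> carrier_mat d d \<and> mat_ge (C k) 1) \<and>
      (\<forall>i<d. \<forall>j<d. (\<Sum>k<n. (C k * D ^\<^sub>m Suc k) $$ (i,j)) = 1\<^sub>m d $$ (i,j)))" for n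
    by (rule rank_block_col_iff[OF D s_seq_bound[OF D]]) auto
  show ?thesis
  proof
    assume "\<exists>n\<ge>1. rank_mod v \<sigma> (s_seq v D n) (block_col \<sigma> (s_seq v D n) D n) d"
    then obtain n C where "\<And>k. k < n \<Longrightarrow> C k \<in> carrier_mat d d \<and> mat_ge (C k) 1"
      "\<And>i j. i < d \<Longrightarrow> j < d \<Longrightarrow> (\<Sum>k<n. (C k * D ^\<^sub>m Suc k) $$ (i,j)) = 1\<^sub>m d $$ (i,j)"
      unfolding iff by blast
    then show "expanding D" by (rule expandingI_left[OF D])
  next
    assume "expanding D"
    then obtain E n where En: "E \<in> carrier_mat d d" "n \<ge> 1" "mat_ge (E ^\<^sub>m n) 1"
      "E ^\<^sub>m n * D ^\<^sub>m n = 1\<^sub>m d" using expandingE[OF D] by metis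
    obtain m where m: "n = Suc m" using En(2) by (cases n) auto
    define C where "C = (\<lambda>k. if k = m then E ^\<^sub>m n else 0\<^sub>m d d)"
    have "(\<Sum>k<n. (C k * D ^\<^sub>m Suc k) $$ (i,j)) = 1\<^sub>m d $$ (i,j)" if "i < d" "j < d" for i j
    proof -
      have zero: "0\<^sub>m d d * D ^\<^sub>m Suc k = 0\<^sub>m d d" for k
        using D by (intro left_mult_zero_mat) auto
      have "(\<Sum>k<n. (C k * D ^\<^sub>m Suc k) $$ (i,j)) = (\<Sum>k<n. if k = m then 1\<^sub>m d $$ (i,j) else 0)"
        using En(4) that by (intro sum.cong) (auto simp: C_def m zero simp del: index_mult_mat pow_mat.simps)
      then show ?thesis by (simp add: m)
    qed
    moreover have "C k \<in> carrier_mat d d \<and> mat_ge (C k) 1" if "k < n" for k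
      using En(1,3) by (auto simp: C_def mat_over_def)
    ultimately show "\<exists>n\<ge>1. rank_mod v \<sigma> (s_seq v D n) (block_col \<sigma> (s_seq v D n) D n) d"
      unfolding iff using En(2) by blast
  qed
qed

lemma rank_block_row_iff_expanding:
  assumes D: "D \<in> carrier_mat d d"
  shows "(\<exists>n\<ge>1. rank_mod v \<sigma> (s_seq v D n) (block_row \<sigma> (s_seq v D n) D n) d) \<longleftrightarrow> expanding D"
proof -
  have iff: "rank_mod v \<sigma> (s_seq v D n) (block_row \<sigma> (s_seq v D n) D n) d \<longleftrightarrow>
    (\<exists>C. (\<forall>k<n. C k \<in> carrier_mat d d \<and> mat_ge (C k) 1) \<and>
      (\<forall>i<d. \<forall>j<d. (\<Sum>k<n. (D ^\<^sub>m Suc k * C k) $$ (i,j)) = 1\<^sub>m d $$ (i,j)))" for n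
    by (rule rank_block_row_iff[OF D s_seq_bound[OF D]]) auto
  show ?thesis
  proof
    assume "\<exists>n\<ge>1. rank_mod v \<sigma> (s_seq v D n) (block_row \<sigma> (s_seq v D n) D n) d"
    then obtain n C where "\<And>k. k < n \<Longrightarrow> C k \<in> carrier_mat d d \<and> mat_ge (C k) 1"
      "\<And>i j. i < d \<Longrightarrow> j < d \<Longrightarrow> (\<Sum>k<n. (D ^\<^sub>m Suc k * C k) $$ (i,j)) = 1\<^sub>m d $$ (i,j)"
      unfolding iff by blast
    then show "expanding D" by (rule expandingI_right[OF D])
  next
    assume "expanding D"
    then obtain E n where En: "E \<in> carrier_mat d d" "n \<ge> 1" "mat_ge (E ^\<^sub>m n) 1"
      "D ^\<^sub>m n * E ^\<^sub>m n = 1\<^sub>m d" using expandingE[OF D] by metis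
    obtain m where m: "n = Suc m" using En(2) by (cases n) auto
    define C where "C = (\<lambda>k. if k = m then E ^\<^sub>m n else 0\<^sub>m d d)"
    have "(\<Sum>k<n. (D ^\<^sub>m Suc k * C k) $$ (i,j)) = 1\<^sub>m d $$ (i,j)" if "i < d" "j < d" for i j
    proof -
      have zero: "D ^\<^sub>m Suc k * 0\<^sub>m d d = 0\<^sub>m d d" for k
        using D by (intro right_mult_zero_mat) auto
      have "(\<Sum>k<n. (D ^\<^sub>m Suc k * C k) $$ (i,j)) = (\<Sum>k<n. if k = m then 1\<^sub>m d $$ (i,j) else 0)"
        using En(4) that by (intro sum.cong) (auto simp: C_def m zero simp del: index_mult_mat pow_mat.simps)
      then show ?thesis by (simp add: m)
    qed
    moreover have "C k \<in> carrier_mat d d \<and> mat_ge (C k) 1" if "k < n" for k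
      using En(1,3) by (auto simp: C_def mat_over_def)
    ultimately show "\<exists>n\<ge>1. rank_mod v \<sigma> (s_seq v D n) (block_row \<sigma> (s_seq v D n) D n) d"
      unfolding iff using En(2) by blast
  qed
qed

end

section \<open>Power series with coefficients tending to zero\<close>

text \<open>Power series multiply with noncommuting coefficients and a central variable, exactly as
  \<open>pmult\<close> prescribes for polynomials, so this embedding gives access to ring
  reasoning.\<close>

definition fps_of :: "'a::ring_1 poly \<Rightarrow> 'a fps" where
  "fps_of p = Abs_fps (coeff p)"

lemma fps_of_nth [simp]: "fps_nth (fps_of p) n = coeff p n"
  by (simp add: fps_of_def)

lemma fps_of_add: "fps_of (p + q) = fps_of p + fps_of q"
  by (intro fps_ext) simp

lemma fps_of_0 [simp]: "fps_of 0 = 0"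
  by (intro fps_ext) simp

lemma fps_of_pone [simp]: "fps_of pone = 1"
  by (intro fps_ext) (auto simp: pone_def coeff_pCons split: nat.splits)

lemma fps_of_pmult: "fps_of (pmult p q) = fps_of p * fps_of q"
proof (rule fps_ext)
  fix n
  have inner: "(\<Sum>j\<le>degree q. coeff (monom (coeff p i * coeff q j) (i + j)) n)
      = (if i \<le> n then coeff p i * coeff q (n - i) else 0)" for i
  proof -
    have "(\<Sum>j\<le>degree q. coeff (monom (coeff p i * coeff q j) (i + j)) n)
        = (\<Sum>j\<le>degree q. if j = n - i then if i \<le> n then coeff p i * coeff q j else 0 else 0)"
      by (intro sum.cong) auto
    also have "\<dots> = (if i \<le> n then coeff p i * coeff q (n - i) else 0)"
      by (auto simp: coeff_eq_0)
    finally show ?thesis .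
  qed
  have "fps_nth (fps_of (pmult p q)) n = (\<Sum>i\<le>degree p. if i \<le> n then coeff p i * coeff q (n - i) else 0)"
    by (simp only: fps_of_nth pmult_def coeff_sum inner)
  also have "\<dots> = (\<Sum>i\<in>{i\<in>{..degree p}. i \<le> n}. coeff p i * coeff q (n - i))"
    by (rule sum.inter_filter[symmetric]) simp
  also have "\<dots> = (\<Sum>i=0..n. coeff p i * coeff q (n - i))"
    by (rule sum.mono_neutral_left) (auto intro: le_degree)
  finally show "fps_nth (fps_of (pmult p q)) n = fps_nth (fps_of p * fps_of q) n"
    by (simp add: fps_mult_nth)
qed

lemma subring1_range_fps_of: "subring1 (range (fps_of :: 'a::ring_1 poly \<Rightarrow> _))"
proof -
  have "- fps_of p = fps_of (- p)" for p :: "'a poly" by (intro fps_ext) simp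
  moreover have "0 \<in> range (fps_of :: 'a poly \<Rightarrow> _)" "1 \<in> range (fps_of :: 'a poly \<Rightarrow> _)"
    by (metis fps_of_0 rangeI) (metis fps_of_pone rangeI)
  ultimately show ?thesis
    by (auto simp: subring1_def fps_of_add[symmetric] fps_of_pmult[symmetric])
qed

context valued_skew_field
begin

text \<open>The Tate algebra in one central variable: the power series that converge on the closed
  unit disc.\<close>

definition tate :: "'a fps set" where
  "tate = {g. \<forall>k. \<forall>\<^sub>F m in sequentially. val_ge v (fps_nth g m) k}"

lemma tateD: "g \<in> tate \<Longrightarrow> \<exists>M. \<forall>m\<ge>M. val_ge v (fps_nth g m) k"
  by (auto simp: tate_def eventually_sequentially)

lemma tateI: "(\<And>k. \<exists>M. \<forall>m\<ge>M. val_ge v (fps_nth g m) k) \<Longrightarrow> g \<in> tate"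
  by (auto simp: tate_def eventually_sequentially)

lemma fps_of_in_tate: "fps_of p \<in> tate"
  by (rule tateI, rule exI[of _ "Suc (degree p)"]) (auto simp: coeff_eq_0)

lemma tate_add:
  assumes "f \<in> tate" "g \<in> tate" shows "f + g \<in> tate"
proof -
  have "\<forall>\<^sub>F m in sequentially. val_ge v (fps_nth (f + g) m) k" for k
    using assms[unfolded tate_def, THEN CollectD, rule_format, of k]
    by eventually_elim (simp add: val_ge_add)
  then show ?thesis by (simp add: tate_def)
qed

lemma tate_bounded:
  assumes "g \<in> tate" obtains b where "\<And>m. val_ge v (fps_nth g m) b" "b \<le> 0"
proof -
  obtain M where M: "\<And>m. m \<ge> M \<Longrightarrow> val_ge v (fps_nth g m) 0" using tateD[OF assms] by blast
  define b where "b = Min (insert 0 ((\<lambda>m. v (fps_nth g m)) ` {..<M}))"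
  have "b \<le> 0" by (simp add: b_def)
  moreover have "val_ge v (fps_nth g m) b" for m
  proof (cases "m < M")
    case True
    then have "b \<le> v (fps_nth g m)" by (auto simp: b_def intro!: Min_le)
    then show ?thesis by (simp add: val_ge_def)
  qed (use M val_ge_mono \<open>b \<le> 0\<close> in \<open>auto simp: not_less\<close>)
  ultimately show ?thesis using that by blast
qed

text \<open>In every term of a late coefficient one of the two indices is large. The other factor is
  merely bounded, and the thresholds \<open>k - b\<close> and \<open>k - a\<close> compensate for
  that.\<close>

lemma tate_mult:
  assumes f: "f \<in> tate" and g: "g \<in> tate" shows "f * g \<in> tate"
proof (rule tateI)
  fix k
  obtain a where a: "\<And>m. val_ge v (fps_nth f m) a" "a \<le> 0" using tate_bounded[OF f] by blast
  obtain b where b: "\<And>m. val_ge v (fps_nth g m) b" "b \<le> 0" using tate_bounded[OF g] by blast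
  obtain M where M: "\<And>m. m \<ge> M \<Longrightarrow> val_ge v (fps_nth f m) (k - b)" using tateD[OF f] by blast
  obtain N where N: "\<And>m. m \<ge> N \<Longrightarrow> val_ge v (fps_nth g m) (k - a)" using tateD[OF g] by blast
  have "val_ge v (fps_nth (f * g) m) k" if m: "m \<ge> M + N" for m
    unfolding fps_mult_nth
  proof (rule val_ge_sum)
    fix i assume i: "i \<in> {0..m}"
    show "val_ge v (fps_nth f i * fps_nth g (m - i)) k"
    proof (cases "i \<ge> M")
      case True
      then show ?thesis using val_ge_mult[OF M b(1), of i "m - i"] by simp
    next
      case False
      then show ?thesis using val_ge_mult[OF a(1) N, of "m - i" i] m i by simp
    qed
  qed
  then show "\<exists>M. \<forall>m\<ge>M. val_ge v (fps_nth (f * g) m) k" by blast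
qed

lemma bimodule_over_tate: "bimodule_over (range fps_of) tate"
  using fps_of_in_tate[of 0]
  by (auto simp: bimodule_over_def intro: tate_add tate_mult fps_of_in_tate)

text \<open>Coefficients tending to zero can attain the least valuation only finitely often, so
  there is a last place \<open>a\<close> where it is attained.\<close>

lemma tate_last_min:
  assumes h: "h \<in> tate" "h \<noteq> 0"
  obtains a where "fps_nth h a \<noteq> 0" "\<And>i. val_ge v (fps_nth h i) (v (fps_nth h a))"
    "\<And>i. i > a \<Longrightarrow> val_ge v (fps_nth h i) (v (fps_nth h a) + 1)"
proof -
  obtain b where b: "fps_nth h b \<noteq> 0" using h(2) by (auto simp: fps_eq_iff)
  define u where "u = (\<lambda>i. v (fps_nth h i))"
  \<comment> \<open>From \<open>M\<close> on all valuations exceed that of the nonzero coefficient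
    at \<open>b\<close>, so the minimum is attained in the finite set \<open>S\<close>
    below.\<close>
  obtain M where M: "\<And>m. m \<ge> M \<Longrightarrow> val_ge v (fps_nth h m) (u b + 1)"
    using tateD[OF h(1)] by blast
  define S where "S = {i. i < M \<and> fps_nth h i \<noteq> 0}"
  have S: "finite S" by (simp add: S_def)
  have "b \<in> S" using b M[of b] by (fastforce simp: S_def val_ge_def u_def not_less)
  define w where "w = Min (u ` S)"
  have w: "w \<in> u ` S" "\<And>i. i \<in> S \<Longrightarrow> w \<le> u i"
    using S \<open>b \<in> S\<close> by (auto simp: w_def intro!: Min_in)
  define A where "A = {i\<in>S. u i = w}"
  define a where "a = Max A"
  have A: "finite A" "A \<noteq> {}" using S w(1) by (auto simp: A_def)
  have "a \<in> A" using A by (auto simp: a_def)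
  then have a: "fps_nth h a \<noteq> 0" "u a = w" by (auto simp: A_def S_def)
  have out: "val_ge v (fps_nth h i) (w + 1)" if "i \<notin> S" for i
  proof (cases "i < M")
    case False
    then show ?thesis using M[of i] val_ge_mono[of _ "u b + 1" "w + 1"] w(2)[OF \<open>b \<in> S\<close>] by auto
  qed (use that in \<open>auto simp: S_def\<close>)
  have "val_ge v (fps_nth h i) w" for i
    using out[of i] w(2)[of i] val_ge_mono[of _ "w + 1" w]
    by (cases "i \<in> S") (auto simp: val_ge_def u_def)
  moreover have "val_ge v (fps_nth h i) (w + 1)" if "i > a" for i
  proof (cases "i \<in> S")
    case True
    have "i \<notin> A" using that Max_ge[OF A(1), of i] by (auto simp: a_def)
    with True w(2)[of i] show ?thesis by (auto simp: A_def val_ge_def u_def)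
  qed (rule out)
  ultimately show ?thesis using that[of a] a by (auto simp: u_def)
qed

text \<open>Equivalently, \<open>f\<close> divided by its constant coefficient is integral and
  congruent to 1 modulo \<open>\<sigma>\<close>.\<close>

definition const_dominant :: "'a poly \<Rightarrow> bool" where
  "const_dominant f \<longleftrightarrow> coeff f 0 \<noteq> 0 \<and> (\<forall>i>0. val_ge v (coeff f i) (v (coeff f 0) + 1))"

text \<open>A Gauss lemma: the last positions where the two factors attain their minimal
  valuations add up to such a position of the product, which for the product \<open>1\<close> is \<open>0\<close>.\<close>

lemma tate_left_inverse_imp_dominant:
  assumes g: "g \<in> tate" and gf: "g * fps_of f = 1"
  shows "const_dominant f"
proof -
  define h where "h = fps_of f"
  have nz: "h \<noteq> 0" "g \<noteq> 0" using gf by (auto simp: h_def)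
  obtain a where a: "fps_nth h a \<noteq> 0" "\<And>i. val_ge v (fps_nth h i) (v (fps_nth h a))"
    "\<And>i. i > a \<Longrightarrow> val_ge v (fps_nth h i) (v (fps_nth h a) + 1)"
    using tate_last_min[OF fps_of_in_tate[of f, folded h_def] nz(1)] by blast
  obtain b where b: "fps_nth g b \<noteq> 0" "\<And>i. val_ge v (fps_nth g i) (v (fps_nth g b))"
    "\<And>i. i > b \<Longrightarrow> val_ge v (fps_nth g i) (v (fps_nth g b) + 1)"
    using tate_last_min[OF g nz(2)] by blast
  define w where "w = v (fps_nth g b) + v (fps_nth h a)"
  define y where "y = fps_nth g b * fps_nth h a"
  define z where "z = (\<Sum>i\<in>{0..b + a} - {b}. fps_nth g i * fps_nth h (b + a - i))"
  have "fps_nth (g * h) (b + a) = y + z"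
    unfolding fps_mult_nth y_def z_def by (subst sum.remove[of _ b]) auto
  moreover have "val_ge v z (w + 1)"
    unfolding z_def
  proof (rule val_ge_sum)
    fix i assume i: "i \<in> {0..b + a} - {b}"
    show "val_ge v (fps_nth g i * fps_nth h (b + a - i)) (w + 1)"
    proof (cases "i > b")
      case True
      then show ?thesis using val_ge_mult[OF b(3) a(2), of i "b + a - i"] by (simp add: w_def algebra_simps)
    next
      case False
      with i have "b + a - i > a" by auto
      then show ?thesis using val_ge_mult[OF b(2) a(3), of "b + a - i" i] by (simp add: w_def algebra_simps)
    qed
  qed
  \<comment> \<open>If \<open>y + z\<close> were zero, \<open>z = - y\<close> would have valuation
    \<open>w\<close>, contrary to the bound \<open>w + 1\<close>.\<close>
  moreover have "y \<noteq> 0" "v y = w" using a(1) b(1) by (auto simp: y_def w_def v_mult)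
  then have "y + z \<noteq> 0" if "val_ge v z (w + 1)"
    using that v_minus[of y] by (auto simp: val_ge_def add_eq_0_iff)
  ultimately have "fps_nth (g * h) (b + a) \<noteq> 0" by simp
  then have "a = 0" using gf by (auto simp: h_def split: if_splits)
  then show ?thesis using a by (auto simp: const_dominant_def h_def)
qed

text \<open>The formal left inverse is built by a recursion whose multipliers
  \<open>coeff f j * x\<close> with \<open>j > 0\<close> have valuation at least 1. As
  \<open>f\<close> is a polynomial, only boundedly many earlier coefficients enter, so the recursion
  contracts.\<close>

lemma dominant_imp_tate_left_inverse:
  assumes f: "const_dominant f"
  shows "\<exists>g\<in>tate. g * fps_of f = 1"
proof -
  define x where "x = inverse (coeff f 0)"
  define g where "g = fps_left_inverse (fps_of f) x"
  have f0: "coeff f 0 \<noteq> 0" using f by (simp add: const_dominant_def)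
  have fx: "val_ge v (coeff f i * x) 1" if "i > 0" for i
    using f that val_ge_mult[of "coeff f i" "v (coeff f 0) + 1" x "- v (coeff f 0)"]
    by (auto simp: const_dominant_def x_def val_ge_def[of v "inverse _"] v_inverse)
  have gf: "g * fps_of f = 1"
    unfolding g_def using f0 by (intro fps_left_inverse) (simp add: x_def)
  have gSuc: "fps_nth g (Suc n) = - (\<Sum>i=0..n. fps_nth g i * (coeff f (Suc n - i) * x))" for n
    by (simp add: g_def sum_distrib_right mult.assoc)
  have "\<forall>\<^sub>F m in sequentially. val_ge v (fps_nth g m) k" for k
  \<comment> \<open>In the formula for the coefficient at \<open>m + Suc (degree f)\<close>, an
    index \<open>i < m\<close> is paired with a coefficient of \<open>f\<close> beyond its degree,
    hence with 0; the window of length \<open>Suc (degree f)\<close> covers all other terms.\<close>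
  proof (rule recursion_tends_to_zero[of "\<lambda>m. val_ge v (fps_nth g m)" "Suc (degree f)"])
    fix m k assume W: "val_ge v (fps_nth g (m + j)) k" if "j < Suc (degree f)" for j
    have "val_ge v (fps_nth g i * (coeff f (Suc (m + degree f) - i) * x)) (k + 1)"
      if i: "i \<in> {0..m + degree f}" for i
    proof (cases "i < m")
      case True
      then show ?thesis by (simp add: coeff_eq_0)
    next
      case False
      then show ?thesis using W[of "i - m"] i by (intro val_ge_mult fx) auto
    qed
    then show "val_ge v (fps_nth g (m + Suc (degree f))) (k + 1)"
      unfolding add_Suc_right gSuc val_ge_minus by (rule val_ge_sum)
  next
    show "\<exists>k. val_ge v (fps_nth g m) k" for m by (auto simp: val_ge_def)
  qed (rule val_ge_mono)
  then show ?thesis using gf by (auto simp: tate_def)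
qed

text \<open>Write a left inverse \<open>G\<close> of \<open>t - D\<close> as a series with matrix
  coefficients \<open>c m\<close>. Comparing coefficients gives \<open>c 0 * D = - 1\<close> and
  \<open>c (Suc m) * D = c m\<close>, which forces \<open>c m = - E ^\<^sub>m Suc m\<close> with
  \<open>E = - c 0\<close>. So \<open>G\<close> has entries in \<open>tate\<close> exactly when the
  powers of \<open>E\<close> tend to zero.\<close>

lemma left_inv_tate_char_mat:
  assumes D: "D \<in> carrier_mat d d"
  shows "left_inv_over tate (map_mat fps_of (char_mat D)) \<longleftrightarrow> expanding D"
proof -
  define A where "A = map_mat fps_of (char_mat D)"
  have A: "A \<in> carrier_mat d d" using D by (auto simp: A_def char_mat_def)
  have Anth: "fps_nth (A $$ (l,j)) i = (if i = 0 then - D $$ (l,j) else if i = 1 \<and> l = j then 1 else 0)"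
    if "l < d" "j < d" for l j i
    using that D by (auto simp: A_def char_mat_def coeff_pCons split: nat.splits)
  have prod: "fps_nth ((G * A) $$ (i,j)) m = (if m = 0 then 0 else fps_nth (G $$ (i,j)) (m - 1))
      - (\<Sum>l<d. fps_nth (G $$ (i,l)) m * D $$ (l,j))"
    if G: "G \<in> carrier_mat d d" and ij: "i < d" "j < d" for G i j m
  proof -
    have entry: "fps_nth (G $$ (i,l) * A $$ (l,j)) m =
        (if l = j then if m = 0 then 0 else fps_nth (G $$ (i,j)) (m - 1) else 0)
        - fps_nth (G $$ (i,l)) m * D $$ (l,j)" if "l < d" for l
    proof (cases m)
      case 0
      then show ?thesis using that ij by (simp add: Anth)
    next
      case (Suc q)
      have "(\<Sum>r=0..Suc q. fps_nth (G $$ (i,l)) r * fps_nth (A $$ (l,j)) (Suc q - r))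
          = (\<Sum>r\<in>{q, Suc q}. fps_nth (G $$ (i,l)) r * fps_nth (A $$ (l,j)) (Suc q - r))"
        using that ij by (intro sum.mono_neutral_right) (auto simp: Anth)
      then show ?thesis using that ij by (simp add: fps_mult_nth Suc Anth)
    qed
    have "fps_nth ((G * A) $$ (i,j)) m = (\<Sum>l<d. fps_nth (G $$ (i,l) * A $$ (l,j)) m)"
      using mat_index_mult_sum[OF G A ij] by (simp add: fps_sum_nth)
    then show ?thesis using entry ij by (simp add: sum_subtractf)
  qed
  show ?thesis
    unfolding A_def[symmetric]
  proof
    assume "left_inv_over tate A"
    then obtain G where G: "G \<in> carrier_mat d d" "mat_over tate G" "G * A = 1\<^sub>m d"
      using A by (auto simp: left_inv_over_def)
    define c where "c = (\<lambda>m. mat d d (\<lambda>(i,j). fps_nth (G $$ (i,j)) m))"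
    have c: "c m \<in> carrier_mat d d" for m by (simp add: c_def)
    have cD: "(c m * D) $$ (i,j) = (if m = 0 then 0 else c (m - 1) $$ (i,j)) - fps_nth (1\<^sub>m d $$ (i,j)) m"
      if ij: "i < d" "j < d" for i j m
      using prod[OF G(1) ij, of m] mat_index_mult_sum[OF c[of m] D ij] ij by (simp add: G(3) c_def)
    define E where "E = - c 0"
    have E: "E \<in> carrier_mat d d" by (simp add: E_def c)
    have ED: "E * D = 1\<^sub>m d"
    proof (rule eq_matI, goal_cases)
      case (1 i j)
      then have "(E * D) $$ (i,j) = - ((c 0 * D) $$ (i,j))"
        using D c[of 0] by (simp add: E_def uminus_scalar_prod)
      then show ?case using cD[of i j 0] 1 by simp
    qed (use E D in auto)
    have DE: "D * E = 1\<^sub>m d" using right_inverse_imp_left_inverse[OF E D ED] .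
    have cSuc: "c (Suc m) * D = c m" for m
    proof (rule eq_matI, goal_cases)
      case (1 i j)
      then have "i < d" "j < d" by (auto simp: c_def)
      from cD[OF this, of "Suc m"] show ?case using \<open>i < d\<close> \<open>j < d\<close> by (simp del: index_mult_mat)
    qed (use c D in \<open>auto simp: c_def\<close>)
    have rec: "c (Suc m) = c m * E" for m
      using assoc_mult_mat[OF c D E, of "Suc m"] DE right_mult_one_mat[OF c] by (simp add: cSuc)
    have cE: "E ^\<^sub>m Suc m = - c m" for m
    proof (induction m)
      case (Suc m)
      then have "E ^\<^sub>m Suc (Suc m) = - c m * E" by simp
      also have "\<dots> = - (c m * E)" using c[of m] E by simp
      finally show ?case by (simp add: rec)
    qed (use E in \<open>auto simp: E_def\<close>)
    have "\<forall>\<^sub>F m in sequentially. mat_ge (E ^\<^sub>m m) k" for k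
    proof -
      have "\<forall>\<^sub>F m in sequentially. val_ge v (fps_nth (G $$ (i,j)) m) k" if "i < d" "j < d" for i j
        using G(1,2) that by (auto simp: mat_over_def tate_def)
      then have "\<forall>\<^sub>F m in sequentially. \<forall>i\<in>{..<d}. \<forall>j\<in>{..<d}. val_ge v (fps_nth (G $$ (i,j)) m) k"
        by (intro eventually_ball_finite ballI) auto
      then have "\<forall>\<^sub>F m in sequentially. mat_ge (E ^\<^sub>m Suc m) k"
        by eventually_elim (simp add: cE mat_over_def c_def del: pow_mat.simps)
      then show ?thesis by (subst eventually_sequentially_Suc[symmetric])
    qed
    then show "expanding D" using D E DE ED by (auto simp: expanding_def)
  next
    assume "expanding D"
    then obtain E where E: "E \<in> carrier_mat d d" "D * E = 1\<^sub>m d" "E * D = 1\<^sub>m d"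
      and lim: "\<And>k. \<forall>\<^sub>F m in sequentially. mat_ge (E ^\<^sub>m m) k"
      using D by (auto simp: expanding_def)
    define G where "G = mat d d (\<lambda>(i,j). Abs_fps (\<lambda>m. - (E ^\<^sub>m Suc m) $$ (i,j)))"
    have G: "G \<in> carrier_mat d d" by (simp add: G_def)
    have ED: "E ^\<^sub>m Suc m * D = E ^\<^sub>m m" for m
      using E D by (simp add: assoc_mult_mat[of _ d d _ d _ d])
    have "G * A = 1\<^sub>m d"
    proof (rule eq_matI, goal_cases)
      case (1 i j)
      then have ij: "i < d" "j < d" by auto
      show ?case
      proof (rule fps_ext)
        fix m
        have "(\<Sum>l<d. fps_nth (G $$ (i,l)) m * D $$ (l,j)) = - (E ^\<^sub>m Suc m * D) $$ (i,j)"
          using ij E(1) D mat_index_mult_sum[OF _ D ij, of "E ^\<^sub>m Suc m"]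
          by (simp add: G_def sum_negf del: index_mult_mat pow_mat.simps)
        also have "\<dots> = - (E ^\<^sub>m m) $$ (i,j)" unfolding ED ..
        finally show "fps_nth ((G * A) $$ (i,j)) m = fps_nth (1\<^sub>m d $$ (i,j)) m"
          unfolding prod[OF G ij] using ij E(1)
          by (cases m) (auto simp: G_def simp del: index_mult_mat)
      qed
    qed (use G A in auto)
    moreover have "mat_over tate G"
      unfolding mat_over_def
    proof (intro allI impI)
      fix i j assume ij: "i < dim_row G" "j < dim_col G"
      have "\<forall>\<^sub>F m in sequentially. val_ge v (fps_nth (G $$ (i,j)) m) k" for k
      proof -
        have "\<forall>\<^sub>F m in sequentially. mat_ge (E ^\<^sub>m Suc m) k"
          using lim by (subst eventually_sequentially_Suc)
        then show ?thesis
          by eventually_elim (use ij E(1) in \<open>auto simp: G_def mat_over_def simp del: pow_mat.simps\<close>)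
      qed
      then show "G $$ (i,j) \<in> tate" by (auto simp: tate_def)
    qed
    ultimately show "left_inv_over tate A" using G A by (auto simp: left_inv_over_def)
  qed
qed

text \<open>The last diagonal entry of a left inverse inverts the last factor. Conversely, if
  \<open>lam (i + 1) = pmult c (lam i)\<close> and \<open>g\<close> inverts
  \<open>lam (i + 1)\<close> from the left, then \<open>g * fps_of c\<close> inverts
  \<open>lam i\<close>, so invertibility descends along the chain.\<close>

lemma left_inv_tate_diag:
  assumes "d \<ge> 1" and div: "\<And>i. i + 1 < d \<Longrightarrow> right_divides (lam i) (lam (i + 1))"
  shows "left_inv_over tate (map_mat fps_of (mat d d (\<lambda>(i,j). if i = j then lam i else 0)))
    \<longleftrightarrow> (\<exists>g\<in>tate. g * fps_of (lam (d - 1)) = 1)"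
proof -
  define A where "A = map_mat fps_of (mat d d (\<lambda>(i,j). if i = j then lam i else 0))"
  have A: "A \<in> carrier_mat d d" by (simp add: A_def)
  have prod: "(G * A) $$ (i,j) = G $$ (i,j) * fps_of (lam j)"
    if G: "G \<in> carrier_mat d d" and ij: "i < d" "j < d" for G i j
  proof -
    have "(G * A) $$ (i,j) = (\<Sum>l<d. G $$ (i,l) * A $$ (l,j))"
      by (rule mat_index_mult_sum[OF G A ij])
    also have "\<dots> = (\<Sum>l<d. if l = j then G $$ (i,j) * fps_of (lam j) else 0)"
      using ij by (intro sum.cong) (auto simp: A_def)
    finally show ?thesis using ij by simp
  qed
  show ?thesis unfolding A_def[symmetric]
  proof
    assume "left_inv_over tate A"
    then obtain G where G: "G \<in> carrier_mat d d" "mat_over tate G" "G * A = 1\<^sub>m d"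
      using A by (auto simp: left_inv_over_def)
    have "d - 1 < d" using assms(1) by simp
    with prod[OF G(1), of "d - 1" "d - 1"] G(3) have "G $$ (d - 1, d - 1) * fps_of (lam (d - 1)) = 1"
      by simp
    moreover have "G $$ (d - 1, d - 1) \<in> tate" using G(1,2) \<open>d - 1 < d\<close> by (auto simp: mat_over_def)
    ultimately show "\<exists>g\<in>tate. g * fps_of (lam (d - 1)) = 1" by blast
  next
    assume top: "\<exists>g\<in>tate. g * fps_of (lam (d - 1)) = 1"
    \<comment> \<open>Subtraction on naturals truncates: for \<open>j \<ge> d - 1\<close> the index
      is 0, and the induction step there repeats its hypothesis.\<close>
    have all: "\<exists>g\<in>tate. g * fps_of (lam (d - 1 - j)) = 1" for j
    proof (induction j)
      case (Suc j)
      show ?case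
      proof (cases "Suc j \<le> d - 1")
        case True
        define i where "i = d - 1 - Suc j"
        have i: "i + 1 < d" "d - 1 - j = i + 1" using True by (auto simp: i_def)
        obtain c where c: "lam (i + 1) = pmult c (lam i)"
          using div[OF i(1)] by (auto simp: right_divides_def)
        obtain g where g: "g \<in> tate" "g * fps_of (lam (i + 1)) = 1" using Suc i(2) by auto
        have "(g * fps_of c) * fps_of (lam i) = 1"
          using g(2) unfolding c fps_of_pmult by (simp only: mult.assoc)
        then show ?thesis unfolding i_def[symmetric]
          using tate_mult[OF g(1) fps_of_in_tate] by blast
      qed (use Suc in \<open>simp add: not_le\<close>)
    qed (use top in auto)
    have "\<forall>i. \<exists>g. i < d \<longrightarrow> g \<in> tate \<and> g * fps_of (lam i) = 1"
    proof
      fix i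
      show "\<exists>g. i < d \<longrightarrow> g \<in> tate \<and> g * fps_of (lam i) = 1"
      proof (cases "i < d")
        case True
        then have "d - 1 - (d - 1 - i) = i" by simp
        then show ?thesis using all[of "d - 1 - i"] by auto
      qed simp
    qed
    then obtain g where g: "\<And>i. i < d \<Longrightarrow> g i \<in> tate \<and> g i * fps_of (lam i) = 1" by metis
    define G where "G = mat d d (\<lambda>(i,j). if i = j then g i else 0)"
    have G: "G \<in> carrier_mat d d" by (simp add: G_def)
    have "G * A = 1\<^sub>m d"
    proof (rule eq_matI, goal_cases)
      case (1 i j)
      then have ij: "i < d" "j < d" by auto
      show ?case unfolding prod[OF G ij] using g ij by (auto simp: G_def)
    qed (use G A in auto)
    moreover have "mat_over tate G"
      using g fps_of_in_tate[of 0] by (auto simp: mat_over_def G_def)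
    ultimately show "left_inv_over tate A" using G A by (auto simp: left_inv_over_def)
  qed
qed

lemma expanding_iff_dominant:
  assumes D: "D \<in> carrier_mat d d" and "d \<ge> 1" and inv: "invariant_factors D lam"
  shows "expanding D \<longleftrightarrow> const_dominant (lam (d - 1))"
proof -
  define \<Lambda> where "\<Lambda> = mat d d (\<lambda>(i,j). if i = j then lam i else 0)"
  have red: "elem_reduces pmult pone UNIV (char_mat D) \<Lambda>"
    and div: "\<And>i. i + 1 < d \<Longrightarrow> right_divides (lam i) (lam (i + 1))"
    using inv D by (auto simp: invariant_factors_def Let_def \<Lambda>_def)
  have "expanding D \<longleftrightarrow> left_inv_over tate (map_mat fps_of (char_mat D))"
    using left_inv_tate_char_mat[OF D] by simp
  also have "\<dots> \<longleftrightarrow> left_inv_over tate (map_mat fps_of \<Lambda>)"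
    using elem_reduces_inv_iff[OF red fps_of_add fps_of_pmult fps_of_pone subring1_range_fps_of
        bimodule_over_tate] by simp
  also have "\<dots> \<longleftrightarrow> (\<exists>g\<in>tate. g * fps_of (lam (d - 1)) = 1)"
    unfolding \<Lambda>_def by (rule left_inv_tate_diag[OF \<open>d \<ge> 1\<close>]) (rule div)
  also have "\<dots> \<longleftrightarrow> const_dominant (lam (d - 1))"
    using tate_left_inverse_imp_dominant dominant_imp_tate_left_inverse by blast
  finally show ?thesis .
qed

end

section \<open>The Newton polygon\<close>

text \<open>The vertical section at \<open>x\<close> of the convex hull of the points
  \<open>(i, v (coeff f i))\<close>, named so that its infimum can be bounded from both
  sides.\<close>

definition newton_set :: "('a::division_ring \<Rightarrow> int) \<Rightarrow> 'a poly \<Rightarrow> real \<Rightarrow> real set" where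
  "newton_set v f x = {(\<Sum>i\<in>S. c i * real_of_int (v (coeff f i))) | S c.
       finite S \<and> S \<subseteq> {i. coeff f i \<noteq> 0} \<and> (\<forall>i\<in>S. 0 \<le> c i) \<and> (\<Sum>i\<in>S. c i) = 1
       \<and> (\<Sum>i\<in>S. c i * real i) = x}"

lemma newton_fun_eq_Inf: "newton_fun v f x = Inf (newton_set v f x)"
  by (simp add: newton_fun_def newton_set_def)

lemma newton_setI:
  assumes "finite S" "S \<subseteq> {i. coeff f i \<noteq> 0}" "\<And>i. i \<in> S \<Longrightarrow> 0 \<le> c i" "(\<Sum>i\<in>S. c i) = 1"
    "(\<Sum>i\<in>S. c i * real i) = x" "(\<Sum>i\<in>S. c i * real_of_int (v (coeff f i))) = y"
  shows "y \<in> newton_set v f x"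
  unfolding newton_set_def using assms by blast

lemma newton_setE:
  assumes "y \<in> newton_set v f x"
  obtains S c where "finite S" "S \<subseteq> {i. coeff f i \<noteq> 0}" "\<And>i. i \<in> S \<Longrightarrow> 0 \<le> c i"
    "(\<Sum>i\<in>S. c i) = 1" "(\<Sum>i\<in>S. c i * real i) = x"
    "y = (\<Sum>i\<in>S. c i * real_of_int (v (coeff f i)))"
  using assms unfolding newton_set_def by blast

lemma newton_set_bdd_below: "bdd_below (newton_set v f x)"
proof -
  \<comment> \<open>For a zero coefficient \<open>v\<close> has an arbitrary integer value;
    including it can only lower \<open>B\<close>.\<close>
  define B where "B = Min ((\<lambda>i. real_of_int (v (coeff f i))) ` {..degree f})"
  have "B \<le> y" if mem: "y \<in> newton_set v f x" for y
  proof -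
    obtain S c where S: "finite S" "S \<subseteq> {i. coeff f i \<noteq> 0}" "\<And>i. i \<in> S \<Longrightarrow> 0 \<le> c i"
      "(\<Sum>i\<in>S. c i) = 1" "(\<Sum>i\<in>S. c i * real i) = x"
      "y = (\<Sum>i\<in>S. c i * real_of_int (v (coeff f i)))"
      using newton_setE[OF mem] by blast
    have "B = (\<Sum>i\<in>S. c i * B)" using S(4) by (simp flip: sum_distrib_right)
    also have "\<dots> \<le> y"
      unfolding S(6)
    proof (intro sum_mono mult_left_mono S(3))
      fix i assume "i \<in> S"
      then have "i \<le> degree f" using S(2) by (auto intro: le_degree)
      then show "B \<le> real_of_int (v (coeff f i))" by (auto simp: B_def intro!: Min_le)
    qed
    finally show ?thesis .
  qed
  then show ?thesis by (auto simp: bdd_below_def)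
qed

text \<open>Nonnegative weights on indices \<open>i \<ge> 0\<close> with mean 0 must all sit at
  \<open>i = 0\<close>, so the hull has a single point above 0.\<close>

lemma newton_set_0:
  assumes "coeff f 0 \<noteq> 0"
  shows "newton_set v f 0 = {real_of_int (v (coeff f 0))}"
proof -
  have "y = real_of_int (v (coeff f 0))" if mem: "y \<in> newton_set v f 0" for y
  proof -
    obtain S c where S: "finite S" "S \<subseteq> {i. coeff f i \<noteq> 0}" "\<And>i. i \<in> S \<Longrightarrow> 0 \<le> c i"
      "(\<Sum>i\<in>S. c i) = 1" "(\<Sum>i\<in>S. c i * real i) = 0"
      "y = (\<Sum>i\<in>S. c i * real_of_int (v (coeff f i)))"
      using newton_setE[OF mem] by blast
    have "\<forall>i\<in>S. c i * real i = 0" using S(1,3,5) by (subst sum_nonneg_eq_0_iff[symmetric]) auto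
    then have z: "c i = 0" if "i \<in> S" "i \<noteq> 0" for i using that by auto
    then have "y = (\<Sum>i\<in>S. c i * real_of_int (v (coeff f 0)))"
      unfolding S(6) by (intro sum.cong refl) (metis mult_zero_left)
    then show ?thesis using S(4) by (simp flip: sum_distrib_right)
  qed
  moreover have "real_of_int (v (coeff f 0)) \<in> newton_set v f 0"
    using assms by (intro newton_setI[of "{0}" _ "\<lambda>_. 1"]) auto
  ultimately show ?thesis by blast
qed

context valued_skew_field
begin

text \<open>A strictly increasing polygon puts the value at 0 strictly below every
  \<open>v (coeff f i)\<close> with \<open>i > 0\<close>, and integrality makes the gap at least 1.
  Conversely, this gap lifts the polygon strictly above its starting height at every positive
  abscissa, and convexity then gives strict increase.\<close>

lemma np_slopes_positive_iff_dominant: "np_slopes_positive v f \<longleftrightarrow> const_dominant f"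
proof (cases "coeff f 0 = 0")
  case True
  then show ?thesis by (simp add: np_slopes_positive_def const_dominant_def)
next
  case f0: False
  define v0 where "v0 = real_of_int (v (coeff f 0))"
  define n where "n = degree f"
  have N0: "newton_fun v f 0 = v0"
    using f0 by (simp add: newton_fun_eq_Inf newton_set_0 v0_def)
  show ?thesis
  proof
    assume "np_slopes_positive v f"
    then have mono: "strict_mono_on {0..real n} (newton_fun v f)"
      by (simp add: np_slopes_positive_def n_def)
    have "val_ge v (coeff f i) (v (coeff f 0) + 1)" if i: "i > 0" for i
    proof (cases "coeff f i = 0")
      case False
      then have "i \<le> n" by (simp add: n_def le_degree)
      have "newton_fun v f 0 < newton_fun v f (real i)"
        using mono i \<open>i \<le> n\<close> by (auto intro: strict_mono_onD)
      also have "\<dots> \<le> real_of_int (v (coeff f i))"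
        unfolding newton_fun_eq_Inf using False
        by (intro cInf_lower newton_set_bdd_below newton_setI[of "{i}" _ "\<lambda>_. 1"]) auto
      finally show ?thesis unfolding N0 v0_def val_ge_def by linarith
    qed simp
    then show "const_dominant f" using f0 by (simp add: const_dominant_def)
  next
    assume dom: "const_dominant f"
    have vi: "v0 + 1 \<le> real_of_int (v (coeff f i))" if "i > 0" "coeff f i \<noteq> 0" for i
    proof -
      have "v (coeff f 0) + 1 \<le> v (coeff f i)"
        using dom that by (auto simp: const_dominant_def val_ge_def)
      then show ?thesis unfolding v0_def by linarith
    qed
    have "newton_fun v f x < newton_fun v f y" if xy: "0 \<le> x" "x < y" "y \<le> real n" for x y
    proof -
      have n: "n > 0" "y > 0" using xy by (auto intro!: gr0I)
      \<comment> \<open>The rise at \<open>y\<close> of the line from \<open>(0, v0)\<close> to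
        \<open>(n, v0 + 1)\<close>. All points of \<open>f\<close> lie on or above that line, hence
        so does their hull.\<close>
      define e where "e = y / real n"
      have e: "e > 0" using n by (simp add: e_def)
      have low: "v0 + e \<le> w" if mem: "w \<in> newton_set v f y" for w
      proof -
        obtain S c where S: "finite S" "S \<subseteq> {i. coeff f i \<noteq> 0}" "\<And>i. i \<in> S \<Longrightarrow> 0 \<le> c i"
          "(\<Sum>i\<in>S. c i) = 1" "(\<Sum>i\<in>S. c i * real i) = y"
          "w = (\<Sum>i\<in>S. c i * real_of_int (v (coeff f i)))"
          using newton_setE[OF mem] by blast
        have "v0 + e = (\<Sum>i\<in>S. c i * (v0 + real i / real n))"
          using S(4,5) by (simp add: e_def distrib_left sum.distrib flip: sum_distrib_right sum_divide_distrib)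
        also have "\<dots> \<le> w"
          unfolding S(6)
        proof (intro sum_mono mult_left_mono S(3))
          fix i assume "i \<in> S"
          then have i: "coeff f i \<noteq> 0" using S(2) by auto
          then have "i \<le> n" by (simp add: n_def le_degree)
          then have "real i / real n \<le> 1" using n by simp
          then show "v0 + real i / real n \<le> real_of_int (v (coeff f i))"
            using vi[OF _ i] by (cases "i = 0") (auto simp: v0_def)
        qed
        finally show ?thesis .
      qed
      have "coeff f n \<noteq> 0" using f0 by (auto simp: n_def)
      \<comment> \<open>Weights that express \<open>y\<close> through the end points 0 and
        \<open>n\<close>, both with nonzero coefficients; they show that the section at
        \<open>y\<close> is not empty.\<close>
      define c where "c = (\<lambda>i. if i = n then y / real n else 1 - y / real n)"
      have "(\<Sum>i\<in>{0,n}. c i * real_of_int (v (coeff f i))) \<in> newton_set v f y"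
        using \<open>coeff f n \<noteq> 0\<close> f0 n xy
        by (intro newton_setI[of "{0,n}" _ c]) (auto simp: c_def)
      then have ne: "newton_set v f y \<noteq> {}" by blast
      from ne have Ny: "v0 + e \<le> newton_fun v f y"
        unfolding newton_fun_eq_Inf using low by (intro cInf_greatest)
      \<comment> \<open>\<open>x\<close> is the mean of \<open>y\<close> and 0 with weights
        \<open>s\<close> and \<open>1 - s\<close>; convexity is applied along the segment that
        starts at \<open>(0, v0)\<close>.\<close>
      define s where "s = x / y"
      have s: "0 \<le> s" "s < 1" "s * y = x" using xy n by (auto simp: s_def)
      have mix: "newton_fun v f x \<le> s * w + (1 - s) * v0" if mem: "w \<in> newton_set v f y" for w
      proof -
        obtain S c where S: "finite S" "S \<subseteq> {i. coeff f i \<noteq> 0}" "\<And>i. i \<in> S \<Longrightarrow> 0 \<le> c i"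
          "(\<Sum>i\<in>S. c i) = 1" "(\<Sum>i\<in>S. c i * real i) = y"
          "w = (\<Sum>i\<in>S. c i * real_of_int (v (coeff f i)))"
          using newton_setE[OF mem] by blast
        \<comment> \<open>The weights for \<open>y\<close> scaled by \<open>s\<close>, plus mass
          \<open>1 - s\<close> at index 0. The index 0 may or may not lie in \<open>S\<close>, hence
          the conditional and the sums over \<open>insert 0 S\<close>.\<close>
        define c' where "c' = (\<lambda>i. s * (if i \<in> S then c i else 0) + (if i = 0 then 1 - s else 0))"
        have c': "(\<Sum>i\<in>insert 0 S. c' i * g i) = s * (\<Sum>i\<in>S. c i * g i) + (1 - s) * g 0" for g
        proof -
          have "(\<Sum>i\<in>insert 0 S. c' i * g i)
              = (\<Sum>i\<in>insert 0 S. if i \<in> S then s * (c i * g i) else 0)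
                + (\<Sum>i\<in>insert 0 S. if i = 0 then (1 - s) * g 0 else 0)"
            unfolding sum.distrib[symmetric]
            by (intro sum.cong) (auto simp: c'_def algebra_simps)
          also have "(\<Sum>i\<in>insert 0 S. if i \<in> S then s * (c i * g i) else 0) = (\<Sum>i\<in>S. s * (c i * g i))"
            using S(1) by (intro sum.mono_neutral_cong_right) auto
          also have "(\<Sum>i\<in>insert 0 S. if i = 0 then (1 - s) * g 0 else 0) = (1 - s) * g 0"
            using S(1) by (subst sum.delta) auto
          finally show ?thesis by (simp add: sum_distrib_left)
        qed
        have "s * w + (1 - s) * v0 \<in> newton_set v f x"
        proof (rule newton_setI[of "insert 0 S" _ c'])
          show "(\<Sum>i\<in>insert 0 S. c' i) = 1" using c'[of "\<lambda>_. 1"] S(4) by simp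
          show "(\<Sum>i\<in>insert 0 S. c' i * real i) = x" using c'[of real] S(5) s by simp
          show "(\<Sum>i\<in>insert 0 S. c' i * real_of_int (v (coeff f i))) = s * w + (1 - s) * v0"
            unfolding c' by (simp add: S(6) v0_def)
        qed (use S f0 s in \<open>auto simp: c'_def\<close>)
        then show ?thesis unfolding newton_fun_eq_Inf by (intro cInf_lower newton_set_bdd_below)
      qed
      \<comment> \<open>Passing from \<open>mix\<close> to the infimum over \<open>w\<close> divides
        by \<open>s\<close>, so \<open>s = 0\<close> is treated apart.\<close>
      have "newton_fun v f x \<le> s * newton_fun v f y + (1 - s) * v0"
      proof (cases "s = 0")
        case True
        then show ?thesis using mix ne by auto
      next
        case False
        with s have "s > 0" by simp
        then have "(newton_fun v f x - (1 - s) * v0) / s \<le> w" if "w \<in> newton_set v f y" for w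
          using mix[OF that] by (simp add: field_simps)
        then have "(newton_fun v f x - (1 - s) * v0) / s \<le> newton_fun v f y"
          unfolding newton_fun_eq_Inf[of v f y] using ne by (intro cInf_greatest)
        then show ?thesis using \<open>s > 0\<close> by (simp add: field_simps)
      qed
      also have "\<dots> = newton_fun v f y - (1 - s) * (newton_fun v f y - v0)" by (simp add: algebra_simps)
      also have "\<dots> < newton_fun v f y" using s Ny e by simp
      finally show ?thesis .
    qed
    then have "strict_mono_on {0..real n} (newton_fun v f)"
      by (intro strict_mono_onI) auto
    then show "np_slopes_positive v f" using f0 by (simp add: np_slopes_positive_def n_def)
  qed
qed

end

lemma complete_dvf_imp_valued_skew_field: "complete_dvf v \<sigma> \<Longrightarrow> valued_skew_field v \<sigma>"
  unfolding complete_dvf_def by unfold_locales auto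

theorem theorem4p1:
  fixes v :: "'a::division_ring \<Rightarrow> int" and \<sigma> :: 'a
    and D :: "'a mat" and d :: nat and lam :: "nat \<Rightarrow> 'a poly"
  assumes "complete_dvf v \<sigma>"
    and "d \<ge> 1" and "D \<in> carrier_mat d d" and "D \<noteq> 0\<^sub>m d d"
    and "invariant_factors D lam"
  shows "((\<exists>n\<ge>1. rank_mod v \<sigma> (s_seq v D n) (\<sigma> ^ s_seq v D n \<cdot>\<^sub>m (D ^\<^sub>m n)) d)
           \<longleftrightarrow> (\<exists>n\<ge>1. rank_mod v \<sigma> (s_seq v D n) (block_col \<sigma> (s_seq v D n) D n) d))
       \<and> ((\<exists>n\<ge>1. rank_mod v \<sigma> (s_seq v D n) (\<sigma> ^ s_seq v D n \<cdot>\<^sub>m (D ^\<^sub>m n)) d)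
           \<longleftrightarrow> (\<exists>n\<ge>1. rank_mod v \<sigma> (s_seq v D n) (block_row \<sigma> (s_seq v D n) D n) d))
       \<and> ((\<exists>n\<ge>1. rank_mod v \<sigma> (s_seq v D n) (\<sigma> ^ s_seq v D n \<cdot>\<^sub>m (D ^\<^sub>m n)) d)
           \<longleftrightarrow> np_slopes_positive v (lam (d - 1)))"
proof -
  interpret valued_skew_field v \<sigma>
    using complete_dvf_imp_valued_skew_field[OF assms(1)] .
  show ?thesis
    using rank_power_iff_expanding[OF assms(3)] rank_block_col_iff_expanding[OF assms(3)]
      rank_block_row_iff_expanding[OF assms(3)] expanding_iff_dominant[OF assms(3,2,5)]
      np_slopes_positive_iff_dominant by simp
qed

end
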